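(* Let $C_n(\mathbb{R}^2)=\{(x_1,\dots,x_n)\in(\mathbb{R}^2)^n : x_i\neq x_j \text{ for } i\neq j\}$ denote the configuration space of ordered sequences of $n$ distinct points on the plane. Then the topological complexity of $C_n(\mathbb{R}^2)$ equals $2n-2$, i.e. $\mathbf{TC}(C_n(\mathbb{R}^2))=2n-2$.
   Context: For a connected CW complex (or space of that homotopy type) $X$, let $PX$ be the space of all continuous paths $\gamma:[0,1]\to X$ with the compact-open topology, and let $\pi:PX\to X\times X$, $\pi(\gamma)=(\gamma(0),\gamma(1))$. The topological complexity $\mathbf{TC}(X)$ is the smallest number $k$ such that $X\times X$ can be covered by $k$ open sets $U_1,\dots,U_k$ such that for every $i=1,\dots,k$ there is a continuous map $s_i:U_i\to PX$ with $\pi\circ s_i=\mathrm{id}_{U_i}$. (This is the unreduced normalization: $\mathbf{TC}$ of a contractible space is $1$.)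
   Formalization: The formal theorem assumes n ≥ 2; for n = 1 the configuration space is the contractible plane, whose topological complexity is 1 and not 2n−2 = 0. *)

theory Defs
  imports "HOL-Analysis.Analysis" "HOL-Library.Extended_Nat"
begin

text \<open>
  Paths are represented by functions on the reals that are \<^const>\<open>undefined\<close> outside the unit
  interval, so that distinct elements of the path space are distinct as maps on \<open>[0,1]\<close>.
\<close>

definition paths :: "'a topology \<Rightarrow> (real \<Rightarrow> 'a) set" where
  "paths X = {g \<in> extensional {0..1}. continuous_map (top_of_set {0..1}) X g}"

text \<open>The compact-open topology on the set of paths.\<close>

definition path_space :: "'a topology \<Rightarrow> (real \<Rightarrow> 'a) topology" where
  "path_space X = topology_generated_by
     {{g \<in> paths X. g ` K \<subseteq> U} | K U. compact K \<and> K \<subseteq> {0..1} \<and> openin X U}"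

definition path_ends :: "(real \<Rightarrow> 'a) \<Rightarrow> 'a \<times> 'a" where
  "path_ends g = (g 0, g 1)"

definition has_motion_planner :: "'a topology \<Rightarrow> nat \<Rightarrow> bool" where
  "has_motion_planner X k \<longleftrightarrow>
     (\<exists>U :: nat \<Rightarrow> ('a \<times> 'a) set.
        (\<forall>i\<in>{1..k}. openin (prod_topology X X) (U i)) \<and>
        topspace (prod_topology X X) = (\<Union>i\<in>{1..k}. U i) \<and>
        (\<forall>i\<in>{1..k}. \<exists>s. continuous_map (subtopology (prod_topology X X) (U i)) (path_space X) s \<and>
                         (\<forall>p\<in>U i. path_ends (s p) = p)))"

text \<open>
  Unreduced normalization. The value is \<open>\<infinity>\<close> if no finite cover of the required kind exists.
\<close>

definition TC :: "'a topology \<Rightarrow> enat" where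
  "TC X = Inf {enat k | k. has_motion_planner X k}"

definition config_space :: "nat \<Rightarrow> 'a topology \<Rightarrow> (nat \<Rightarrow> 'a) topology" where
  "config_space n X = subtopology (product_topology (\<lambda>_. X) {1..n})
     {x. \<forall>i\<in>{1..n}. \<forall>j\<in>{1..n}. i \<noteq> j \<longrightarrow> x i \<noteq> x j}"

lemma topspace_path_space: "topspace (path_space X) = paths X"
proof -
  have "paths X = {g \<in> paths X. g ` {} \<subseteq> {}}"
    by simp
  then have "paths X \<in> {{g \<in> paths X. g ` K \<subseteq> U} | K U. compact K \<and> K \<subseteq> {0..1} \<and> openin X U}"
    by (intro CollectI exI[of _ "{}"]) auto
  then show ?thesis
    unfolding path_space_def topology_generated_by_topspace by blast
qed

lemma topspace_config_space:
  "topspace (config_space n X) = {x \<in> {1..n} \<rightarrow>\<^sub>E topspace X. inj_on x {1..n}}"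
  by (auto simp: config_space_def inj_on_def)

end

theory Submission
  imports Defs
begin

text \<open>
  A section of the path fibration over an open set \<open>U\<close> is the same as a homotopy between the two
  projections \<open>U \<rightarrow> X\<close>; this is the form in which motion planners are handled.

  Lower bound. A torus of dimension \<open>2n - 3\<close> maps to \<open>C\<^sub>n(\<complex>) \<times> C\<^sub>n(\<complex>)\<close> by letting the points of the first
  configuration move on large circles and those of the second on small ones. Each torus coordinate
  is, up to a factor with a continuous logarithm, the quotient \<open>(x\<^sub>b - x\<^sub>a) / (y\<^sub>b - y\<^sub>a)\<close>
  for some pair \<open>(a, b)\<close>. Over a set with a section these quotients have a continuous logarithm, so
  \<open>2n - 3\<close> such sets would cover the torus by closed sets on the \<open>i\<close>-th of which the \<open>i\<close>-th coordinate
  has a continuous logarithm, against Brouwer's fixed point theorem. This replaces the usual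
  computation of a zero-divisor cup product.

  Upper bound. \<open>C\<^sub>n(\<complex>)\<close> is \<open>\<complex>\<^sup>*\<close> times the space of configurations with \<open>x\<^sub>2 - x\<^sub>1 = 1\<close>. The latter is cut
  into convex cells by the lexicographic order of the points, and the number of distinct real parts
  takes the values \<open>2, \<dots>, n\<close>; on \<open>\<complex>\<^sup>* \<times> \<complex>\<^sup>*\<close> one distinguishes antipodal directions. The sum of the
  three indices is lower semicontinuous with \<open>2n - 2\<close> values, and on each level set a motion is
  given by moving inside cells and between chosen base points. By Tietze's theorem the motion
  extends from a level set to an open neighbourhood.
\<close>

section \<open>Motion planners as homotopies\<close>

text \<open>Evaluation is continuous because the unit interval is locally compact: a compact
  neighbourhood of \<open>t\<close> that the path sends into \<open>V\<close> defines a subbasic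
  open set of the compact-open topology.\<close>

lemma continuous_map_path_space_eval:
  assumes s: "continuous_map Z (path_space X) s"
  shows "continuous_map (prod_topology (top_of_set {0..1}) Z) X (\<lambda>(t, z). s z t)"
proof -
  have paths: "s z \<in> paths X" if "z \<in> topspace Z" for z
    using s that by (auto simp: continuous_map_def topspace_path_space)
  have path: "continuous_map (top_of_set {0..1}) X (s z)" if "z \<in> topspace Z" for z
    using paths[OF that] by (simp add: paths_def)
  have "openin (prod_topology (top_of_set {0..1}) Z)
          {p \<in> topspace (prod_topology (top_of_set {0..1}) Z). (case p of (t, z) \<Rightarrow> s z t) \<in> V}"
    if V: "openin X V" for V
  proof (subst openin_subopen, clarify)
    fix t z
    assume "(t, z) \<in> topspace (prod_topology (top_of_set {0..1}) Z)" and tz: "s z t \<in> V"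
    then have t: "t \<in> {0..1}" and z: "z \<in> topspace Z" by auto
    have "openin (top_of_set {0..1}) {r \<in> {0..1}. s z r \<in> V}"
      using path[OF z] V by (simp add: continuous_map_def)
    moreover have "t \<in> {r \<in> {0..1}. s z r \<in> V}" using t tz by simp
    ultimately obtain e where e: "e > 0" and eV: "\<And>r. r \<in> {0..1} \<Longrightarrow> dist r t < e \<Longrightarrow> s z r \<in> V"
      unfolding openin_euclidean_subtopology_iff by blast
    \<comment> \<open>Halving the radius puts the closed ball inside the ball of radius
      \<open>e\<close>, so \<open>K\<close> is a compact neighbourhood of \<open>t\<close> in the
      interval that the path keeps in \<open>V\<close>.\<close>
    define K where "K = cball t (e/2) \<inter> {0..1}"
    have K: "compact K" "K \<subseteq> {0..1}" by (auto simp: K_def)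
    have sK: "s z ` K \<subseteq> V" using e eV by (auto simp: K_def dist_commute)
    define W where "W = {y \<in> topspace Z. s y \<in> {g \<in> paths X. g ` K \<subseteq> V}}"
    have "openin (path_space X) {g \<in> paths X. g ` K \<subseteq> V}"
      unfolding path_space_def by (rule topology_generated_by_Basis) (use K V in blast)
    then have W: "openin Z W"
      unfolding W_def using s openin_continuous_map_preimage by blast
    have "openin (prod_topology (top_of_set {0..1}) Z) (({0..1} \<inter> ball t (e/2)) \<times> W)"
      using W by (simp add: openin_prod_Times_iff openin_open_Int)
    moreover have "(t, z) \<in> ({0..1} \<inter> ball t (e/2)) \<times> W"
      using t z e sK paths[OF z] by (auto simp: W_def)
    moreover have "({0..1} \<inter> ball t (e/2)) \<times> W
      \<subseteq> {p \<in> topspace (prod_topology (top_of_set {0..1}) Z). (case p of (t, z) \<Rightarrow> s z t) \<in> V}"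
      by (force simp: W_def K_def)
    ultimately show "\<exists>T. openin (prod_topology (top_of_set {0..1}) Z) T \<and> (t, z) \<in> T \<and>
       T \<subseteq> {p \<in> topspace (prod_topology (top_of_set {0..1}) Z). (case p of (t, z) \<Rightarrow> s z t) \<in> V}"
      by blast
  qed
  moreover have "(\<lambda>(t, z). s z t) \<in> topspace (prod_topology (top_of_set {0..1}) Z) \<rightarrow> topspace X"
    using path by (fastforce simp: continuous_map_def)
  ultimately show ?thesis by (simp add: continuous_map_def)
qed

text \<open>It suffices to test subbasic sets, given by a compact \<open>K\<close> and an open
  \<open>V\<close>. The tube lemma widens \<open>K \<times> {z}\<close> inside the open preimage of
  \<open>V\<close> to a product of open sets, whose second factor is the required neighbourhood of
  \<open>z\<close>.\<close>

lemma continuous_map_path_space_curry: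
  assumes h: "continuous_map (prod_topology (top_of_set {0..1}) Z) X h"
  shows "continuous_map Z (path_space X) (\<lambda>z. restrict (\<lambda>t. h (t, z)) {0..1})"
    (is "continuous_map _ _ ?s")
proof -
  have paths: "?s z \<in> paths X" if "z \<in> topspace Z" for z
  proof -
    have "continuous_map (top_of_set {0..1}) X (h \<circ> (\<lambda>t. (t, z)))"
      by (rule continuous_map_compose[OF _ h]) (use that in \<open>simp add: continuous_map_pairedI\<close>)
    then have "continuous_map (top_of_set {0..1}) X (?s z)"
      by (rule continuous_map_eq) auto
    then show ?thesis by (simp add: paths_def)
  qed
  have op: "openin Z (?s -` {g \<in> paths X. g ` K \<subseteq> V} \<inter> topspace Z)"
    if K: "compact K" "K \<subseteq> {0..1}" and V: "openin X V" for K V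
  proof (subst openin_subopen, clarify)
    fix z assume z: "z \<in> topspace Z" and zK: "?s z ` K \<subseteq> V"
    let ?P = "prod_topology (top_of_set {0..1::real}) Z"
    have "openin ?P {p \<in> topspace ?P. h p \<in> V}"
      using h V by (simp add: continuous_map_def)
    moreover have "compactin (top_of_set {0..1}) K"
      using K by (simp add: compactin_subtopology)
    moreover have "K \<times> {z} \<subseteq> {p \<in> topspace ?P. h p \<in> V}"
    proof clarsimp
      fix a assume a: "a \<in> K"
      then have "?s z a \<in> V" using zK by blast
      then show "0 \<le> a \<and> a \<le> 1 \<and> z \<in> topspace Z \<and> h (a, z) \<in> V"
        using a K(2) z by auto
    qed
    ultimately have "\<exists>A B. openin (top_of_set {0..1}) A \<and> openin Z B \<and> K \<subseteq> A \<and> z \<in> B \<and>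
        A \<times> B \<subseteq> {p \<in> topspace ?P. h p \<in> V}"
      using z by (intro tube_lemma_left)
    then obtain A B where AB: "openin Z B" "K \<subseteq> A" "z \<in> B"
        "A \<times> B \<subseteq> {p \<in> topspace ?P. h p \<in> V}"
      by blast
    have "B \<subseteq> ?s -` {g \<in> paths X. g ` K \<subseteq> V} \<inter> topspace Z"
    proof
      fix b assume b: "b \<in> B"
      then have bZ: "b \<in> topspace Z" using openin_subset[OF AB(1)] by blast
      have "h (a, b) \<in> V" if "a \<in> K" for a
        using AB(2,4) b that by blast
      then have "?s b ` K \<subseteq> V" using K(2) by auto
      then show "b \<in> ?s -` {g \<in> paths X. g ` K \<subseteq> V} \<inter> topspace Z"
        using paths[OF bZ] bZ by blast
    qed
    then show "\<exists>T. openin Z T \<and> z \<in> T \<and> T \<subseteq> ?s -` {g \<in> paths X. g ` K \<subseteq> V} \<inter> topspace Z"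
      using AB by blast
  qed
  have "\<Union> {{g \<in> paths X. g ` K \<subseteq> U} |K U. compact K \<and> K \<subseteq> {0..1} \<and> openin X U} = paths X"
    using topspace_path_space[of X] unfolding path_space_def by simp
  then show ?thesis
    unfolding path_space_def continuous_on_generated_topo_iff using op paths by auto
qed

lemma section_iff_homotopic:
  assumes U: "U \<subseteq> topspace (prod_topology X X)"
  shows "(\<exists>s. continuous_map (subtopology (prod_topology X X) U) (path_space X) s \<and>
           (\<forall>p\<in>U. path_ends (s p) = p))
     \<longleftrightarrow> homotopic_with (\<lambda>_. True) (subtopology (prod_topology X X) U) X fst snd"
    (is "?L \<longleftrightarrow> ?R")
proof
  let ?Z = "subtopology (prod_topology X X) U"
  have top: "topspace ?Z = U" using U by (simp add: Int_absorb1)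
  show ?R if ?L
  proof -
    from that obtain s where s: "continuous_map ?Z (path_space X) s" and e: "\<forall>p\<in>U. path_ends (s p) = p"
      by auto
    show ?R
      unfolding homotopic_with[of ?Z "\<lambda>_. True", OF refl]
    proof (intro exI conjI ballI)
      show "continuous_map (prod_topology (top_of_set {0..1}) ?Z) X (\<lambda>(t, z). s z t)"
        by (rule continuous_map_path_space_eval[OF s])
    qed (use e in \<open>auto simp: top path_ends_def prod_eq_iff\<close>)
  qed
  show ?L if ?R
  proof -
    from that obtain h where "continuous_map (prod_topology (top_of_set {0..1::real}) ?Z) X h"
        "\<forall>x. h (0, x) = fst x" "\<forall>x. h (1, x) = snd x"
      unfolding homotopic_with_def by auto
    then show ?L
      using continuous_map_path_space_curry[of ?Z X h]
      by (intro exI[of _ "\<lambda>z. restrict (\<lambda>t. h (t, z)) {0..1}"] conjI) (auto simp: path_ends_def)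
  qed
qed

lemma has_motion_planner_iff_homotopic:
  "has_motion_planner X k \<longleftrightarrow>
    (\<exists>U. (\<forall>i\<in>{1..k}. openin (prod_topology X X) (U i) \<and>
             homotopic_with (\<lambda>_. True) (subtopology (prod_topology X X) (U i)) X fst snd) \<and>
         topspace (prod_topology X X) = (\<Union>i\<in>{1..k}. U i))"
proof -
  let ?P = "prod_topology X X"
  have "(\<forall>i\<in>{1..k}. openin ?P (U i)) \<and> topspace ?P = (\<Union>i\<in>{1..k}. U i) \<and>
        (\<forall>i\<in>{1..k}. \<exists>s. continuous_map (subtopology ?P (U i)) (path_space X) s \<and>
                         (\<forall>p\<in>U i. path_ends (s p) = p))
    \<longleftrightarrow> ((\<forall>i\<in>{1..k}. openin ?P (U i)) \<and>
         (\<forall>i\<in>{1..k}. homotopic_with (\<lambda>_. True) (subtopology ?P (U i)) X fst snd)) \<and>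
        topspace ?P = (\<Union>i\<in>{1..k}. U i)" (is "?A \<and> ?T \<and> ?B \<longleftrightarrow> (?A \<and> ?C) \<and> ?T") for U
  proof -
    have "?B \<longleftrightarrow> ?C" if ?A
      using that by (intro ball_cong refl section_iff_homotopic openin_subset) blast
    then show ?thesis by argo
  qed
  then show ?thesis
    unfolding has_motion_planner_def ball_conj_distrib by (rule ex_cong1)
qed

text \<open>The cover is pulled back along \<open>g\<close> in both coordinates and the homotopies
  are composed with \<open>f\<close>; the ends are right because \<open>f\<close> undoes
  \<open>g\<close>.\<close>

lemma has_motion_planner_homeomorphic_imp:
  assumes "X homeomorphic_space Y" "has_motion_planner X k"
  shows "has_motion_planner Y k"
proof -
  obtain f g where fg: "homeomorphic_maps X Y f g"
    using assms(1) by (auto simp: homeomorphic_space_def)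
  then have f: "continuous_map X Y f" and g: "continuous_map Y X g"
    and fg_id: "\<And>y. y \<in> topspace Y \<Longrightarrow> f (g y) = y"
    by (auto simp: homeomorphic_maps_def)
  obtain U where U: "\<And>i. i \<in> {1..k} \<Longrightarrow> openin (prod_topology X X) (U i)"
    and hom: "\<And>i. i \<in> {1..k} \<Longrightarrow>
          homotopic_with (\<lambda>_. True) (subtopology (prod_topology X X) (U i)) X fst snd"
    and cov: "topspace (prod_topology X X) = (\<Union>i\<in>{1..k}. U i)"
    using assms(2) unfolding has_motion_planner_iff_homotopic by blast
  define gg where "gg = (\<lambda>p. (g (fst p), g (snd p)))"
  have gg: "continuous_map (prod_topology Y Y) (prod_topology X X) gg"
    unfolding gg_def
    using continuous_map_compose[OF continuous_map_fst g] continuous_map_compose[OF continuous_map_snd g]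
    by (intro continuous_map_pairedI) (auto simp: o_def)
  define V where "V i = {p \<in> topspace (prod_topology Y Y). gg p \<in> U i}" for i
  have "openin (prod_topology Y Y) (V i)" if "i \<in> {1..k}" for i
    using gg U[OF that] by (simp add: V_def continuous_map_def)
  moreover have "homotopic_with (\<lambda>_. True) (subtopology (prod_topology Y Y) (V i)) Y fst snd"
    if "i \<in> {1..k}" for i
  proof -
    have "continuous_map (subtopology (prod_topology Y Y) (V i)) (subtopology (prod_topology X X) (U i)) gg"
      using gg by (auto simp: continuous_map_in_subtopology continuous_map_from_subtopology V_def)
    then have "homotopic_with (\<lambda>_. True) (subtopology (prod_topology Y Y) (V i)) Y
        (f \<circ> (fst \<circ> gg)) (f \<circ> (snd \<circ> gg))"
      using hom[OF that] f
      by (intro homotopic_with_compose_continuous_map_left homotopic_with_compose_continuous_map_right) auto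
    then show ?thesis
      by (rule homotopic_with_eq) (auto simp: gg_def fg_id V_def)
  qed
  moreover have "topspace (prod_topology Y Y) = (\<Union>i\<in>{1..k}. V i)"
    using gg cov by (fastforce simp: V_def continuous_map_def)
  ultimately show ?thesis
    unfolding has_motion_planner_iff_homotopic by blast
qed

lemma TC_homeomorphic:
  assumes "X homeomorphic_space Y"
  shows "TC X = TC Y"
proof -
  have "Y homeomorphic_space X"
    using assms by (rule homeomorphic_space_sym[THEN iffD1])
  then have "has_motion_planner X k \<longleftrightarrow> has_motion_planner Y k" for k
    using has_motion_planner_homeomorphic_imp[OF assms] has_motion_planner_homeomorphic_imp[of Y X]
    by (intro iffI)
  then show ?thesis by (simp add: TC_def)
qed

section \<open>Configuration spaces of the plane in complex coordinates\<close>

lemma continuous_map_config_space_map: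
  assumes f: "continuous_map X Y f" and inj: "inj_on f (topspace X)"
  shows "continuous_map (config_space n X) (config_space n Y) (\<lambda>x. restrict (\<lambda>i. f (x i)) {1..n})"
proof -
  have "continuous_map (config_space n X) Y (\<lambda>x. f (x i))" if "i \<in> {1..n}" for i
  proof -
    have "continuous_map (config_space n X) X (\<lambda>x. x i)"
      unfolding config_space_def
      by (rule continuous_map_from_subtopology, rule continuous_map_product_projection[OF that])
    from continuous_map_compose[OF this f] show ?thesis by (simp add: o_def)
  qed
  then have "continuous_map (config_space n X) (product_topology (\<lambda>_. Y) {1..n})
      (\<lambda>x. restrict (\<lambda>i. f (x i)) {1..n})"
    by (auto simp: continuous_map_componentwise)
  moreover have "f (x i) \<noteq> f (x j)"
    if "x \<in> topspace (config_space n X)" "i \<in> {1..n}" "j \<in> {1..n}" "i \<noteq> j" for x i j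
  proof -
    have x: "x i \<in> topspace X" "x j \<in> topspace X" "inj_on x {1..n}"
      using that by (auto simp: topspace_config_space)
    have "x i \<noteq> x j"
      using inj_onD[OF x(3)] that by blast
    then show ?thesis
      using inj_onD[OF inj _ x(1,2)] by blast
  qed
  ultimately show ?thesis
    by (subst (2) config_space_def) (auto simp: continuous_map_in_subtopology)
qed

lemma config_space_homeomorphic:
  assumes "X homeomorphic_space Y"
  shows "config_space n X homeomorphic_space config_space n Y"
proof -
  obtain f g where fg: "homeomorphic_maps X Y f g"
    using assms by (auto simp: homeomorphic_space_def)
  then have f: "continuous_map X Y f" and g: "continuous_map Y X g"
    and fg_id: "\<And>y. y \<in> topspace Y \<Longrightarrow> f (g y) = y" "\<And>x. x \<in> topspace X \<Longrightarrow> g (f x) = x"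
    by (auto simp: homeomorphic_maps_def)
  have "inj_on f (topspace X)" "inj_on g (topspace Y)"
    by (rule inj_on_inverseI, erule fg_id)+
  then have "homeomorphic_maps (config_space n X) (config_space n Y)
      (\<lambda>x. restrict (\<lambda>i. f (x i)) {1..n}) (\<lambda>x. restrict (\<lambda>i. g (x i)) {1..n})"
    unfolding homeomorphic_maps_def
    using continuous_map_config_space_map[OF f] continuous_map_config_space_map[OF g] fg_id
    by (auto simp: topspace_config_space fun_eq_iff PiE_iff extensional_def)
  then show ?thesis by (auto simp: homeomorphic_space_def)
qed

text \<open>Coordinates outside \<open>I\<close> are constantly \<open>undefined\<close> and impose
  no condition, so the product topology is a subspace of the type-class topology on functions. This
  makes \<open>continuous_on\<close> available for configurations.\<close>

lemma product_topology_euclidean_eq_top_of_set: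
  "product_topology (\<lambda>_. euclidean) I = top_of_set (extensional I :: ('i \<Rightarrow> 'a::topological_space) set)"
    (is "?P = ?Q")
proof -
  have top: "topspace ?P = topspace ?Q" by (auto simp: PiE_def)
  have 1: "continuous_map ?Q ?P (\<lambda>x. x)"
    by (auto simp: continuous_map_componentwise
        intro: continuous_on_product_then_coordinatewise continuous_on_id)
  have "continuous_map ?P euclidean (\<lambda>x. x i)" for i
  proof (cases "i \<in> I")
    case False
    have "continuous_map ?P euclidean (\<lambda>x. undefined)" by simp
    then show ?thesis
      by (rule continuous_map_eq) (use False in \<open>auto simp: PiE_def extensional_def\<close>)
  qed (rule continuous_map_product_projection)
  then have 2: "continuous_map ?P ?Q (\<lambda>x. x)"
    by (auto simp: continuous_map_in_subtopology continuous_map_componentwise_UNIV PiE_def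
        simp flip: euclidean_product_topology)
  show ?thesis
    unfolding topology_eq
    using topology_finer_continuous_id[OF top, THEN iffD2] 1
      topology_finer_continuous_id[OF top[symmetric], THEN iffD2] 2
    unfolding id_def by iprover
qed

lemma continuous_on_coordinate: "continuous_on S (\<lambda>w :: 'i \<Rightarrow> 'b::topological_space. w i)"
  by (rule continuous_on_product_then_coordinatewise[OF continuous_on_id])

lemma continuous_on_restrict:
  fixes f :: "'a::topological_space \<Rightarrow> 'i \<Rightarrow> 'b::topological_space"
  assumes "\<And>i. i \<in> I \<Longrightarrow> continuous_on S (\<lambda>x. f x i)"
  shows "continuous_on S (\<lambda>x. restrict (f x) I)"
proof (rule continuous_on_coordinatewise_then_product)
  show "continuous_on S (\<lambda>x. restrict (f x) I i)" for i
    using assms by (cases "i \<in> I") auto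
qed

lemma homotopic_with_canon_imp_ex:
  assumes "homotopic_with_canon (\<lambda>_. True) A B f g"
  shows "\<exists>h. continuous_on ({0..1::real} \<times> A) h \<and> (\<forall>t\<in>{0..1}. \<forall>x\<in>A. h (t, x) \<in> B) \<and>
    (\<forall>x. h (0, x) = f x) \<and> (\<forall>x. h (1, x) = g x)"
proof -
  obtain h where h: "continuous_map (prod_topology (top_of_set {0..1::real}) (top_of_set A)) (top_of_set B) h"
      "\<forall>x. h (0, x) = f x" "\<forall>x. h (1, x) = g x"
    using assms unfolding homotopic_with_def by auto
  then have "continuous_on ({0..1} \<times> A) h" "h \<in> {0..1} \<times> A \<rightarrow> B"
    by auto
  then show ?thesis using h(2,3) by blast
qed

definition Conf :: "nat \<Rightarrow> (nat \<Rightarrow> 'a) set" where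
  "Conf n = {x \<in> extensional {1..n}. inj_on x {1..n}}"

lemma config_space_euclidean:
  "config_space n (euclidean :: 'a::topological_space topology) = top_of_set (Conf n)"
proof -
  have "extensional {1..n} \<inter> {x. \<forall>i\<in>{1..n}. \<forall>j\<in>{1..n}. i \<noteq> j \<longrightarrow> x i \<noteq> x j}
      = (Conf n :: (nat \<Rightarrow> 'a) set)"
    unfolding Conf_def inj_on_def by blast
  then show ?thesis
    unfolding config_space_def product_topology_euclidean_eq_top_of_set subtopology_subtopology by simp
qed

lemma real2_homeomorphic_complex:
  "(euclidean :: (real^2) topology) homeomorphic_space (euclidean :: complex topology)"
proof -
  have "homeomorphic_maps (euclidean :: (real^2) topology) euclidean
      (\<lambda>v. Complex (v $ 1) (v $ 2)) (\<lambda>z. vector [Re z, Im z])"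
    unfolding homeomorphic_maps_def
  proof (intro conjI ballI)
    show "continuous_map euclidean euclidean (\<lambda>v::real^2. Complex (v $ 1) (v $ 2))"
      by (auto intro!: continuous_intros)
    have eq: "(\<lambda>z. vector [Re z, Im z] :: real^2) = (\<lambda>z. \<chi> i. if i = 1 then Re z else Im z)"
      by (auto simp: vec_eq_iff forall_2 fun_eq_iff)
    have "continuous_on UNIV (\<lambda>z. if i = 1 then Re z else Im z)" for i :: 2
      by (cases "i = 1") (auto intro!: continuous_intros)
    then show "continuous_map euclidean euclidean (\<lambda>z. vector [Re z, Im z] :: real^2)"
      unfolding eq by (auto intro!: continuous_on_vec_lambda)
  qed (auto simp: vec_eq_iff forall_2)
  then show ?thesis by (auto simp: homeomorphic_space_def)
qed

lemma has_motion_planner_top_of_set: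
  "has_motion_planner (top_of_set S) k \<longleftrightarrow>
    (\<exists>U. (\<forall>i\<in>{1..k}. openin (top_of_set (S \<times> S)) (U i) \<and>
             homotopic_with_canon (\<lambda>_. True) (U i) S fst snd) \<and>
         S \<times> S = (\<Union>i\<in>{1..k}. U i))"
proof -
  have eq: "subtopology (top_of_set (S \<times> S)) A = top_of_set A" if "openin (top_of_set (S \<times> S)) A" for A
    using openin_imp_subset[OF that] by (simp add: subtopology_subtopology Int_absorb1)
  have "(\<forall>i\<in>{1..k}. openin (top_of_set (S \<times> S)) (U i) \<and>
             homotopic_with (\<lambda>_. True) (subtopology (top_of_set (S \<times> S)) (U i)) (top_of_set S) fst snd)
      \<longleftrightarrow> (\<forall>i\<in>{1..k}. openin (top_of_set (S \<times> S)) (U i) \<and>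
             homotopic_with_canon (\<lambda>_. True) (U i) S fst snd)" for U
    by (rule ball_cong[OF refl], rule conj_cong[OF refl]) (simp only: eq)
  then show ?thesis
    by (simp only: has_motion_planner_iff_homotopic prod_topology_subtopology_eu topspace_euclidean_subtopology)
qed

section \<open>Logarithms of torus coordinates\<close>

text \<open>Infinitely many circles keep the domain independent of \<open>n\<close>, and the product
  is still compact.\<close>

definition infinite_torus :: "(nat \<Rightarrow> complex) set" where
  "infinite_torus = {w. \<forall>i. norm (w i) = 1}"

lemma compact_PiE_UNIV:
  fixes K :: "'i \<Rightarrow> 'a::topological_space set"
  assumes "\<And>i. compact (K i)"
  shows "compact {w. \<forall>i. w i \<in> K i}"
proof -
  have "compactin (product_topology (\<lambda>_. euclidean) UNIV) (PiE UNIV K)"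
    using assms by (subst compactin_PiE) auto
  moreover have "PiE UNIV K = {w. \<forall>i. w i \<in> K i}" by (auto simp: PiE_UNIV_domain)
  ultimately show ?thesis
    by (simp add: euclidean_product_topology)
qed

lemma tendsto_fun_iff:
  fixes f :: "'a \<Rightarrow> 'i \<Rightarrow> 'b::topological_space"
  shows "(f \<longlongrightarrow> l) F \<longleftrightarrow> (\<forall>i. ((\<lambda>x. f x i) \<longlongrightarrow> l i) F)"
  using limitin_componentwise[of "\<lambda>_. euclidean" UNIV f l F]
  by (simp add: euclidean_product_topology)

lemma compact_infinite_torus: "compact infinite_torus"
  using compact_PiE_UNIV[of "\<lambda>_. sphere (0::complex) 1"] by (simp add: infinite_torus_def)

text \<open>Brouwer's theorem with the dimension as a variable, whence the coordinates in
  \<open>nat \<Rightarrow> real\<close>. On the grid of mesh \<open>1 / Suc p\<close>, Kuhn's lemma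
  yields a cell with, for every \<open>i\<close>, two vertices at which \<open>F x i - x i\<close>
  has opposite weak signs. A limit point of these cells is fixed.\<close>

lemma brouwer_nat_cube:
  fixes F :: "(nat \<Rightarrow> real) \<Rightarrow> nat \<Rightarrow> real" and n :: nat
  defines "Q \<equiv> {x. (\<forall>i<n. x i \<in> {0..1}) \<and> (\<forall>i\<ge>n. x i = 0)}"
  assumes cont: "\<And>i. i < n \<Longrightarrow> continuous_on Q (\<lambda>x. F x i)"
    and maps: "\<And>x i. x \<in> Q \<Longrightarrow> i < n \<Longrightarrow> F x i \<in> {0..1}"
  obtains x where "x \<in> Q" "\<And>i. i < n \<Longrightarrow> F x i = x i"
proof -
  have "compact {x :: nat \<Rightarrow> real. \<forall>i. x i \<in> (if i < n then {0..1} else {0})}"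
    by (rule compact_PiE_UNIV) auto
  moreover have "{x :: nat \<Rightarrow> real. \<forall>i. x i \<in> (if i < n then {0..1} else {0})} = Q"
  proof -
    have "x i \<in> (if i < n then {0..1} else {0}) \<longleftrightarrow> (i < n \<longrightarrow> x i \<in> {0..1}) \<and> (i \<ge> n \<longrightarrow> x i = 0)"
      for x :: "nat \<Rightarrow> real" and i by simp
    then show ?thesis unfolding Q_def by (simp only: all_conj_distrib)
  qed
  ultimately have Q: "compact Q" by simp
  define \<sigma> :: "nat \<Rightarrow> (nat \<Rightarrow> nat) \<Rightarrow> nat \<Rightarrow> real"
    where "\<sigma> p x = (\<lambda>i. if i < n then real (x i) / Suc p else 0)" for p x
  have \<sigma>Q: "\<sigma> p x \<in> Q" if x: "\<And>i. i < n \<Longrightarrow> x i \<le> Suc p" for p x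
  proof -
    have "real (x i) \<le> 1 + real p" if i: "i < n" for i
      using x[OF i] by linarith
    then show ?thesis by (auto simp: \<sigma>_def Q_def divide_simps)
  qed
  \<comment> \<open>\<open>r\<close> and \<open>s\<close> are vertices of the grid cell with least
    corner \<open>q\<close>; they witness the two weak signs for coordinate
    \<open>i\<close>.\<close>
  define near_vertices where "near_vertices p q i r s \<longleftrightarrow>
      (\<forall>j<n. q j \<le> r j \<and> r j \<le> q j + 1) \<and> (\<forall>j<n. q j \<le> s j \<and> s j \<le> q j + 1) \<and>
      F (\<sigma> p r) i \<ge> \<sigma> p r i \<and> F (\<sigma> p s) i \<le> \<sigma> p s i" for p q i r s
  have "\<exists>q. (\<forall>i<n. q i < Suc p) \<and> (\<forall>i<n. \<exists>r s. near_vertices p q i r s)" for p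
  proof -
    \<comment> \<open>Kuhn's lemma wants label 1 on the whole face \<open>x i = Suc p\<close>, also
      where \<open>F\<close> fixes the coordinate; hence the extra condition
      \<open>x i < Suc p\<close>. Label 1 still implies the weak inequality there, because
      \<open>F\<close> is at most 1.\<close>
    define label :: "(nat \<Rightarrow> nat) \<Rightarrow> nat \<Rightarrow> nat"
      where "label x i = (if x i < Suc p \<and> F (\<sigma> p x) i \<ge> \<sigma> p x i then 0 else 1)" for x i
    have label1: "F (\<sigma> p x) i \<le> \<sigma> p x i"
      if "\<And>i. i < n \<Longrightarrow> x i \<le> Suc p" "i < n" "label x i \<noteq> 0" for x i
    proof (cases "x i < Suc p")
      case False
      then have "\<sigma> p x i = 1" using that(1)[OF that(2)] that(2) by (simp add: \<sigma>_def)
      then show ?thesis using maps[OF \<sigma>Q that(2), of x p] that(1) by auto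
    next
      case True
      then show ?thesis using that by (auto simp: label_def split: if_splits)
    qed
    have label0: "label x i = 0" if "\<And>i. i < n \<Longrightarrow> x i \<le> Suc p" "i < n" "x i = 0" for x i
      using maps[OF \<sigma>Q that(2), of x p] that by (simp add: label_def \<sigma>_def)
    obtain q where q: "\<forall>i<n. q i < Suc p"
      and rs: "\<forall>i<n. \<exists>r s. (\<forall>j<n. q j \<le> r j \<and> r j \<le> q j + 1) \<and>
                (\<forall>j<n. q j \<le> s j \<and> s j \<le> q j + 1) \<and> label r i \<noteq> label s i"
    proof (rule kuhn_lemma[of "Suc p" n label])
      show "\<forall>x. (\<forall>i<n. x i \<le> Suc p) \<longrightarrow> (\<forall>i<n. label x i = 0 \<or> label x i = 1)"
        by (simp add: label_def)
      show "\<forall>x. (\<forall>i<n. x i \<le> Suc p) \<longrightarrow> (\<forall>i<n. x i = 0 \<longrightarrow> label x i = 0)"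
        using label0 by blast
      show "\<forall>x. (\<forall>i<n. x i \<le> Suc p) \<longrightarrow> (\<forall>i<n. x i = Suc p \<longrightarrow> label x i = 1)"
        by (simp add: label_def)
    qed auto
    have "\<exists>r s. near_vertices p q i r s" if i: "i < n" for i
    proof -
      obtain r s where r: "\<forall>j<n. q j \<le> r j \<and> r j \<le> q j + 1" and s: "\<forall>j<n. q j \<le> s j \<and> s j \<le> q j + 1"
        and lab: "label r i \<noteq> label s i"
        using rs i by blast
      have bd: "r j \<le> Suc p" "s j \<le> Suc p" if "j < n" for j
        using r s q that by (metis Suc_eq_plus1 Suc_leI le_trans Suc_le_mono)+
      show ?thesis
      proof (cases "label r i = 0")
        case True
        then have "F (\<sigma> p r) i \<ge> \<sigma> p r i" by (auto simp: label_def split: if_splits)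
        moreover have "F (\<sigma> p s) i \<le> \<sigma> p s i" using label1[OF bd(2) i] lab True by simp
        ultimately show ?thesis using r s unfolding near_vertices_def by blast
      next
        case False
        then have "F (\<sigma> p s) i \<ge> \<sigma> p s i" using lab by (auto simp: label_def split: if_splits)
        moreover have "F (\<sigma> p r) i \<le> \<sigma> p r i" using label1[OF bd(1) i] False by simp
        ultimately show ?thesis using r s unfolding near_vertices_def by blast
      qed
    qed
    then show ?thesis using q by blast
  qed
  then have "\<forall>p. \<exists>q. (\<forall>i<n. q i < Suc p) \<and> (\<forall>i<n. \<exists>r s. near_vertices p q i r s)"
    by blast
  then obtain q where q: "\<And>p i. i < n \<Longrightarrow> q p i < Suc p"
    and rs: "\<And>p i. i < n \<Longrightarrow> \<exists>r s. near_vertices p (q p) i r s"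
    using choice[of "\<lambda>p q. (\<forall>i<n. q i < Suc p) \<and> (\<forall>i<n. \<exists>r s. near_vertices p q i r s)"] by blast
  define r where "r p i = (SOME r. \<exists>s. near_vertices p (q p) i r s)" for p i
  define s where "s p i = (SOME s. near_vertices p (q p) i (r p i) s)" for p i
  have nv: "near_vertices p (q p) i (r p i) (s p i)" if "i < n" for p i
  proof -
    have "\<exists>s. near_vertices p (q p) i (r p i) s"
      unfolding r_def by (rule someI_ex[OF rs[OF that]])
    then show ?thesis unfolding s_def by (rule someI_ex)
  qed
  have r: "q p j \<le> r p i j \<and> r p i j \<le> q p j + 1" if "i < n" "j < n" for p i j
    using nv[OF that(1)] that(2) by (auto simp: near_vertices_def)
  have s: "q p j \<le> s p i j \<and> s p i j \<le> q p j + 1" if "i < n" "j < n" for p i j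
    using nv[OF that(1)] that(2) by (auto simp: near_vertices_def)
  have Fr: "F (\<sigma> p (r p i)) i \<ge> \<sigma> p (r p i) i" and Fs: "F (\<sigma> p (s p i)) i \<le> \<sigma> p (s p i) i"
    if "i < n" for p i
    using nv[OF that] by (auto simp: near_vertices_def)
  have "\<forall>p. \<sigma> p (q p) \<in> Q" using q by (intro allI \<sigma>Q) (simp add: less_imp_le)
  then obtain x \<rho> where x: "x \<in> Q" and \<rho>: "strict_mono \<rho>"
      and lim: "((\<lambda>p. \<sigma> p (q p)) \<circ> \<rho>) \<longlonglongrightarrow> x"
    using Q unfolding compact_eq_seq_compact_metric by (elim seq_compactE) auto
  \<comment> \<open>Any vertices \<open>t p\<close> of the chosen cells have the same limit
    \<open>x\<close> along \<open>\<rho>\<close>, since the cells shrink. This is used for both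
    \<open>r\<close> and \<open>s\<close>.\<close>
  have near: "(\<lambda>p. F (\<sigma> (\<rho> p) (t (\<rho> p))) i - \<sigma> (\<rho> p) (t (\<rho> p)) i) \<longlonglongrightarrow> F x i - x i"
    if t: "\<And>p j. j < n \<Longrightarrow> q p j \<le> t p j \<and> t p j \<le> q p j + 1" and i: "i < n" for t i
  proof -
    have co: "(\<lambda>p. \<sigma> (\<rho> p) (t (\<rho> p)) j) \<longlonglongrightarrow> x j" for j
    proof -
      have "(\<lambda>p. \<sigma> (\<rho> p) (q (\<rho> p)) j) \<longlonglongrightarrow> x j"
        using lim by (simp add: o_def tendsto_fun_iff)
      moreover have "(\<lambda>p. \<sigma> (\<rho> p) (t (\<rho> p)) j - \<sigma> (\<rho> p) (q (\<rho> p)) j) \<longlonglongrightarrow> 0"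
      proof (rule Lim_null_comparison)
        have "norm (\<sigma> p (t p) j - \<sigma> p (q p) j) \<le> inverse (real (Suc p))" for p
          using t[of j p] by (auto simp: \<sigma>_def diff_divide_distrib[symmetric] divide_simps)
        then show "\<forall>\<^sub>F p in sequentially. norm (\<sigma> (\<rho> p) (t (\<rho> p)) j - \<sigma> (\<rho> p) (q (\<rho> p)) j)
            \<le> inverse (real (Suc (\<rho> p)))" by simp
        show "(\<lambda>p. inverse (real (Suc (\<rho> p)))) \<longlonglongrightarrow> 0"
          using LIMSEQ_subseq_LIMSEQ[OF LIMSEQ_inverse_real_of_nat \<rho>] by (simp add: o_def)
      qed
      ultimately have "(\<lambda>p. (\<sigma> (\<rho> p) (t (\<rho> p)) j - \<sigma> (\<rho> p) (q (\<rho> p)) j) + \<sigma> (\<rho> p) (q (\<rho> p)) j)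
          \<longlonglongrightarrow> 0 + x j"
        by (intro tendsto_add)
      then show ?thesis by simp
    qed
    then have "(\<lambda>p. \<sigma> (\<rho> p) (t (\<rho> p))) \<longlonglongrightarrow> x"
      by (simp add: tendsto_fun_iff)
    moreover have "\<sigma> p (t p) \<in> Q" for p
    proof (rule \<sigma>Q)
      fix i assume "i < n" then show "t p i \<le> Suc p" using t[of i p] q[of i p] by simp
    qed
    ultimately have "(\<lambda>p. F (\<sigma> (\<rho> p) (t (\<rho> p))) i) \<longlonglongrightarrow> F x i"
      by (intro continuous_on_tendsto_compose[OF cont[OF i] _ x]) auto
    then show ?thesis by (intro tendsto_diff co)
  qed
  have "F x i = x i" if i: "i < n" for i
  proof (rule antisym)
    have "F x i - x i \<ge> 0"
      by (rule LIMSEQ_le_const[OF near[of "\<lambda>p. r p i", OF r[OF i] i]]) (use Fr[OF i] in auto)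
    then show "x i \<le> F x i" by simp
    have "F x i - x i \<le> 0"
      by (rule LIMSEQ_le_const2[OF near[of "\<lambda>p. s p i", OF s[OF i] i]]) (use Fs[OF i] in auto)
    then show "F x i \<le> x i" by simp
  qed
  then show ?thesis using that x by blast
qed

text \<open>With a Lebesgue number \<open>e\<close> of the cover, \<open>V i\<close> consists of the
  points of \<open>T\<close> whose \<open>e\<close>-ball lies in \<open>O' i\<close>. It is closed
  in \<open>T\<close> because the excluded points form a union of balls.\<close>

lemma compact_shrinking:
  fixes T :: "'a::metric_space set"
  assumes T: "compact T" and op: "\<And>i. i \<in> I \<Longrightarrow> open (O' i)" and cov: "T \<subseteq> (\<Union>i\<in>I. O' i)"
  obtains V where "\<And>i. i \<in> I \<Longrightarrow> compact (V i)" "\<And>i. i \<in> I \<Longrightarrow> V i \<subseteq> T \<inter> O' i" "T \<subseteq> (\<Union>i\<in>I. V i)"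
proof -
  obtain e where e: "0 < e" and ball: "\<And>x. x \<in> T \<Longrightarrow> \<exists>B\<in>O' ` I. ball x e \<subseteq> B"
    using Heine_Borel_lemma[OF T cov] op by blast
  define V where "V i = T \<inter> {x. ball x e \<subseteq> O' i}" for i
  have "closed {x. ball x e \<subseteq> A}" for A :: "'a set"
  proof -
    have "- {x. ball x e \<subseteq> A} = (\<Union>y\<in>-A. ball y e)"
      by (auto simp: subset_iff dist_commute)
    then show ?thesis by (metis closed_def open_UN open_ball)
  qed
  then have "compact (V i)" for i
    unfolding V_def using T by blast
  moreover have "V i \<subseteq> T \<inter> O' i" for i using e by (auto simp: V_def)
  moreover have "T \<subseteq> (\<Union>i\<in>I. V i)" using ball by (fastforce simp: V_def)
  ultimately show ?thesis using that by blast
qed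

text \<open>Time is cut into steps so short that successive quotients of \<open>z\<close> have
  positive real part. There the principal logarithm is continuous, and the logarithms of the
  quotients add up to \<open>\<Delta>\<close>.\<close>

lemma continuous_log_increment:
  fixes z :: "real \<times> 'a::metric_space \<Rightarrow> complex"
  assumes K: "compact K" and cont: "continuous_on ({0..1} \<times> K) z"
    and nz: "\<And>t p. t \<in> {0..1} \<Longrightarrow> p \<in> K \<Longrightarrow> z (t, p) \<noteq> 0"
  obtains \<Delta> where "continuous_on K \<Delta>" "\<And>p. p \<in> K \<Longrightarrow> z (1, p) = z (0, p) * exp (\<Delta> p)"
proof -
  have cpt: "compact ({0..1::real} \<times> K)" using K by (intro compact_Times) auto
  have "closed (z ` ({0..1} \<times> K))" "0 \<notin> z ` ({0..1} \<times> K)"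
    using compact_continuous_image[OF cont cpt] nz by (auto simp: compact_imp_closed)
  from separate_point_closed[OF this] obtain e
    where e: "e > 0" and ez: "\<And>t p. t \<in> {0..1} \<Longrightarrow> p \<in> K \<Longrightarrow> e \<le> norm (z (t, p))"
    by fastforce
  obtain d where d: "d > 0"
    and dz: "\<And>x y. x \<in> {0..1} \<times> K \<Longrightarrow> y \<in> {0..1} \<times> K \<Longrightarrow> dist y x < d \<Longrightarrow> dist (z y) (z x) < e"
    using compact_uniformly_continuous[OF cont cpt] e unfolding uniformly_continuous_on_def by metis
  \<comment> \<open>The number \<open>e\<close> bounds the modulus of \<open>z\<close> from below
    and \<open>d\<close> belongs to \<open>e\<close> by uniform continuity. Steps of length
    \<open>1 / N\<close> thus change \<open>z\<close> by less than its modulus, which puts each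
    quotient at distance less than 1 from 1.\<close>
  obtain N :: nat where N: "N > 0" "1 / N < d"
    using d by (metis nat_approx_posE of_nat_0_less_iff zero_less_Suc)
  define a where "a j p = z (real j / N, p)" for j p
  have in01: "real j / N \<in> {0..1}" if "j \<le> N" for j using that N by (auto simp: divide_simps)
  have anz: "a j p \<noteq> 0" if "j \<le> N" "p \<in> K" for j p
    unfolding a_def using nz[OF in01[OF that(1)] that(2)] .
  have Re: "Re (a (Suc j) p / a j p) > 0" if j: "j < N" and p: "p \<in> K" for j p
  proof -
    have "real (Suc j) / N - real j / N = 1 / N"
      by (simp add: diff_divide_distrib[symmetric])
    then have "dist (real (Suc j) / N, p) (real j / N, p) < d"
      using N by (simp add: dist_prod_def dist_real_def)
    then have "dist (a (Suc j) p) (a j p) < e"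
      unfolding a_def using in01[of j] in01[of "Suc j"] j p by (intro dz) auto
    also have "e \<le> norm (a j p)" unfolding a_def using ez[OF in01 p, of j] j by simp
    finally have "norm (a (Suc j) p - a j p) / norm (a j p) < 1"
      using anz[of j p] j p by (simp add: dist_norm)
    then have "norm (a (Suc j) p / a j p - 1) < 1"
      using anz[of j p] j p by (simp add: norm_divide[symmetric] diff_divide_distrib)
    then have "\<bar>Re (a (Suc j) p / a j p - 1)\<bar> < 1"
      using abs_Re_le_cmod le_less_trans by blast
    then show ?thesis by simp
  qed
  define \<Delta> where "\<Delta> p = (\<Sum>j<N. Ln (a (Suc j) p / a j p))" for p
  have conta: "continuous_on K (a j)" if "j \<le> N" for j
    unfolding a_def
    by (rule continuous_on_compose2[OF cont]) (use in01[OF that] in \<open>auto intro!: continuous_intros\<close>)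
  have "continuous_on K (\<lambda>p. Ln (a (Suc j) p / a j p))" if j: "j < N" for j
  proof (rule continuous_on_Ln')
    show "continuous_on K (\<lambda>p. a (Suc j) p / a j p)"
      using j anz by (intro continuous_on_divide conta) auto
    show "a (Suc j) p / a j p \<notin> \<real>\<^sub>\<le>\<^sub>0" if "p \<in> K" for p
      using Re[OF j that] by (auto simp: complex_nonpos_Reals_iff)
  qed
  then have "continuous_on K \<Delta>"
    unfolding \<Delta>_def by (intro continuous_on_sum) auto
  moreover have "z (1, p) = z (0, p) * exp (\<Delta> p)" if p: "p \<in> K" for p
  proof -
    define L where "L j = Ln (a (Suc j) p / a j p)" for j
    have step: "a (Suc m) p = a m p * exp (L m)" if "m < N" for m
    proof -
      have "a (Suc m) p / a m p \<noteq> 0" using Re[OF that p] by fastforce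
      then show ?thesis using anz[of m p] that p by (simp add: L_def)
    qed
    have "a m p = a 0 p * exp (\<Sum>j<m. L j)" if "m \<le> N" for m
      using that by (induction m) (auto simp: step exp_add)
    from this[of N] show ?thesis using N by (simp add: a_def \<Delta>_def L_def)
  qed
  ultimately show ?thesis using that by blast
qed

text \<open>Tietze's theorem extends the imaginary part of each logarithm to an angle
  \<open>g i\<close> on the whole torus. Brouwer's theorem finds a point whose \<open>i\<close>-th
  coordinate is opposite to the direction \<open>g i\<close>, for all \<open>i < k\<close> at once.
  This point lies in some \<open>V i\<close>, where the \<open>i\<close>-th coordinate has the
  direction \<open>g i\<close> itself.\<close>

lemma no_coordinate_logs_on_torus:
  fixes V :: "nat \<Rightarrow> (nat \<Rightarrow> complex) set"
  assumes V: "\<And>i. i < k \<Longrightarrow> closed (V i)" "\<And>i. i < k \<Longrightarrow> V i \<subseteq> infinite_torus"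
    and cov: "infinite_torus \<subseteq> (\<Union>i<k. V i)"
    and cont: "\<And>i. i < k \<Longrightarrow> continuous_on (V i) (\<eta> i)"
    and log: "\<And>i w. i < k \<Longrightarrow> w \<in> V i \<Longrightarrow> w i = exp (\<eta> i w)"
  shows False
proof -
  let ?T = infinite_torus
  have "\<exists>g. continuous_on ?T g \<and> (\<forall>w\<in>V i. g w = Im (\<eta> i w))" if "i < k" for i
  proof -
    have cl: "closedin (top_of_set ?T) (V i)"
      using V that by (simp add: closed_subset)
    have "continuous_on (V i) (\<lambda>w. Im (\<eta> i w))"
      using cont[OF that] by (intro continuous_intros)
    from Tietze_unbounded[OF this cl] show ?thesis by metis
  qed
  then obtain g where g: "\<And>i. i < k \<Longrightarrow> continuous_on ?T (g i)"
    and gV: "\<And>i w. i < k \<Longrightarrow> w \<in> V i \<Longrightarrow> g i w = Im (\<eta> i w)"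
    by metis
  have "\<exists>B. \<forall>w\<in>?T. \<bar>g i w\<bar> \<le> B" if "i < k" for i
    using compact_imp_bounded[OF compact_continuous_image[OF g[OF that] compact_infinite_torus]]
    by (auto simp: bounded_iff)
  then obtain B where B: "\<And>i w. i < k \<Longrightarrow> w \<in> ?T \<Longrightarrow> \<bar>g i w\<bar> \<le> B i"
    by metis
  \<comment> \<open>\<open>M\<close> dominates all the angles \<open>pi + g i\<close>, so that
    \<open>F\<close> below maps the cube into itself.\<close>
  define M where "M = pi + (\<Sum>i<k. \<bar>B i\<bar>)"
  have M0: "M > 0" unfolding M_def using pi_gt_zero by (simp add: add_pos_nonneg sum_nonneg)
  have M: "\<bar>pi + g i w\<bar> \<le> M" if "i < k" "w \<in> ?T" for i w
  proof -
    have "\<bar>B i\<bar> \<le> (\<Sum>i<k. \<bar>B i\<bar>)" using that(1) by (intro member_le_sum) auto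
    then show ?thesis using B[OF that] pi_gt_zero unfolding M_def by linarith
  qed
  \<comment> \<open>The cube is wrapped around the torus with angles running from \<open>- M\<close>
    to \<open>M\<close>. A fixed point of \<open>F\<close> is a point whose angles are exactly
    \<open>pi + g i\<close>.\<close>
  define e where "e x = (\<lambda>i. cis (M * (2 * x i - 1)))" for x :: "nat \<Rightarrow> real"
  have eT: "e x \<in> ?T" for x by (simp add: e_def infinite_torus_def)
  have "continuous_on S (\<lambda>x. e x i)" for S i
    unfolding e_def cis_conv_exp
    by (intro continuous_intros continuous_on_product_then_coordinatewise[OF continuous_on_id])
  then have econt: "continuous_on S e" for S
    by (rule continuous_on_coordinatewise_then_product)
  define F where "F x i = ((pi + g i (e x)) / M + 1) / 2" for x i
  obtain x where x: "\<And>i. i < k \<Longrightarrow> F x i = x i"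
  proof (rule brouwer_nat_cube[of k F])
    fix i assume i: "i < k"
    show "continuous_on {x. (\<forall>i<k. x i \<in> {0..1}) \<and> (\<forall>i\<ge>k. x i = 0)} (\<lambda>x. F x i)"
      unfolding F_def using M0 eT
      by (intro continuous_intros continuous_on_compose2[OF g[OF i] econt]) auto
    show "F x i \<in> {0..1}" for x
      using M[OF i eT[of x]] M0 by (auto simp: F_def abs_le_iff divide_simps)
  qed blast
  obtain i where i: "i < k" and xV: "e x \<in> V i" using cov eT[of x] by blast
  have "M * (2 * x i - 1) = pi + g i (e x)"
    using x[OF i] M0 by (simp add: F_def field_simps)
  then have "e x i = cis (pi + Im (\<eta> i (e x)))"
    using gV[OF i xV] by (simp add: e_def)
  also have "\<dots> = - cis (Im (\<eta> i (e x)))"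
    by (simp add: cis_mult[symmetric])
  \<comment> \<open>A positive multiple of a unit vector would equal its negative.\<close>
  finally have "of_real (exp (Re (\<eta> i (e x)))) * cis (Im (\<eta> i (e x))) = - cis (Im (\<eta> i (e x)))"
    using log[OF i xV] by (simp add: exp_eq_polar)
  then have "of_real (exp (Re (\<eta> i (e x))) + 1) * cis (Im (\<eta> i (e x))) = 0"
    by (simp add: distrib_right)
  then have "exp (Re (\<eta> i (e x))) + 1 = 0"
    by (metis cis_neq_zero mult_eq_0_iff of_real_eq_0_iff)
  then show False using exp_gt_zero[of "Re (\<eta> i (e x))"] by linarith
qed

section \<open>The lower bound\<close>

text \<open>
  The coordinate \<open>w (2 * l - 4)\<close> is the direction of the \<open>l\<close>-th point as seen from the first one in the
  outer configuration; \<open>w (2 * l - 5)\<close>, for \<open>l \<ge> 3\<close>, is the ratio of that direction to the corresponding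
  direction in the inner configuration.
\<close>

definition orbits_out :: "nat \<Rightarrow> (nat \<Rightarrow> complex) \<Rightarrow> nat \<Rightarrow> complex" where
  "orbits_out n w = (\<lambda>l\<in>{1..n}. if l = 1 then 0 else of_nat l * w (2 * l - 4))"

definition orbits_in :: "nat \<Rightarrow> (nat \<Rightarrow> complex) \<Rightarrow> nat \<Rightarrow> complex" where
  "orbits_in n w = (\<lambda>l\<in>{1..n}. if l = 1 then 0 else if l = 2 then - 1
     else w (2 * l - 4) / w (2 * l - 5) / of_nat l)"

text \<open>The moduli 0, 2, 3, ..., \<open>n\<close> keep the points apart.\<close>

lemma orbits_out_in_Conf:
  assumes w: "w \<in> infinite_torus"
  shows "orbits_out n w \<in> Conf n"
proof -
  have "norm (orbits_out n w l) = (if l = 1 then 0 else real l)" if "l \<in> {1..n}" for l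
    using that w by (simp add: orbits_out_def infinite_torus_def norm_mult)
  then have "inj_on (norm \<circ> orbits_out n w) {1..n}"
    by (intro inj_onI) (auto split: if_splits)
  then have "inj_on (orbits_out n w) {1..n}"
    by (rule inj_on_imageI2)
  then show ?thesis by (simp add: Conf_def orbits_out_def)
qed

text \<open>The moduli 0, 1, 1/3, ..., 1/\<open>n\<close> keep the points apart.\<close>

lemma orbits_in_in_Conf:
  assumes w: "w \<in> infinite_torus"
  shows "orbits_in n w \<in> Conf n"
proof -
  have "norm (orbits_in n w l) = (if l = 1 then 0 else if l = 2 then 1 else 1 / real l)"
    if "l \<in> {1..n}" for l
    using that w by (simp add: orbits_in_def infinite_torus_def norm_divide norm_mult)
  then have "inj_on (norm \<circ> orbits_in n w) {1..n}"
    by (intro inj_onI) (auto simp: divide_simps split: if_splits)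
  then have "inj_on (orbits_in n w) {1..n}"
    by (rule inj_on_imageI2)
  then show ?thesis by (simp add: Conf_def orbits_in_def)
qed

lemma torus_nonzero: "w \<in> infinite_torus \<Longrightarrow> w i \<noteq> 0"
  by (auto simp: infinite_torus_def dest: spec[of _ i])

lemma continuous_on_orbits_out: "continuous_on S (orbits_out n)"
proof -
  have "continuous_on S (\<lambda>w. if l = 1 then 0 else of_nat l * w (2 * l - 4) :: complex)" for l :: nat
    by (cases "l = 1") (auto intro!: continuous_intros continuous_on_coordinate)
  then show ?thesis
    unfolding orbits_out_def by (intro continuous_on_restrict)
qed

lemma continuous_on_orbits_in: "continuous_on infinite_torus (orbits_in n)"
proof -
  have "continuous_on infinite_torus (\<lambda>w. if l = 1 then 0 else if l = 2 then - 1
     else w (2 * l - 4) / w (2 * l - 5) / of_nat l :: complex)" for l :: nat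
    by (cases "l = 1"; cases "l = 2"; cases "l = 0")
       (auto intro!: continuous_intros continuous_on_coordinate simp: torus_nonzero)
  then show ?thesis
    unfolding orbits_in_def by (intro continuous_on_restrict)
qed

text \<open>The pair (1, 2) accounts for \<open>i = 0\<close>, the pair (1, \<open>l\<close>) for
  \<open>i = 2 * l - 5\<close>, and the pair (2, \<open>l\<close>) for \<open>i = 2 * l - 4\<close>
  with \<open>l \<ge> 3\<close>. In the first two cases the remaining factor is constant, in the
  last it is a quotient of functions with positive real part.\<close>

lemma orbit_coordinate_logs:
  assumes i: "i < 2 * n - 3"
  obtains a b \<psi> where "a \<in> {1..n}" "b \<in> {1..n}" "a \<noteq> b" "continuous_on infinite_torus \<psi>"
    "\<And>w. w \<in> infinite_torus \<Longrightarrow>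
       orbits_out n w b - orbits_out n w a = w i * exp (\<psi> w) * (orbits_in n w b - orbits_in n w a)"
proof -
  consider "i = 0" | "odd i" | "even i" "i > 0" by fastforce
  then show ?thesis
  proof cases
    case 1
    then have n: "n \<ge> 2" using i by simp
    have "exp (Ln (- 2)) = (- 2 :: complex)" by (rule exp_Ln) simp
    then show ?thesis
      using n 1 by (intro that[of 1 2 "\<lambda>_. Ln (- 2)"]) (auto simp: orbits_out_def orbits_in_def)
  next
    case 2
    define l where "l = i div 2 + 3"
    have l: "i = 2 * l - 5" "l \<ge> 3" "l \<le> n"
      using 2 i unfolding l_def by (auto elim!: oddE)
    have "exp (Ln (of_nat l ^ 2)) = (of_nat l ^ 2 :: complex)"
      using l by (intro exp_Ln) auto
    then show ?thesis
      using l by (intro that[of 1 l "\<lambda>_. Ln (of_nat l ^ 2)"])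
        (auto simp: orbits_out_def orbits_in_def torus_nonzero power2_eq_square)
  next
    case 3
    define l where "l = i div 2 + 2"
    have l: "i = 2 * l - 4" "l \<ge> 3" "l \<le> n"
      using 3 i unfolding l_def by (auto elim!: evenE)
    \<comment> \<open>\<open>w i * P w\<close> is the outer difference of the points
      \<open>l\<close> and 2, and \<open>Q w\<close> the inner one. In the outer configuration the
      radius \<open>l\<close> exceeds 2, in the inner one the radius 1 exceeds \<open>1 / l\<close>,
      so \<open>P\<close> and \<open>Q\<close> stay in the right half plane.\<close>
    define P where "P w = of_nat l - 2 * w 0 / w i" for w :: "nat \<Rightarrow> complex"
    define Q where "Q w = 1 + w i / w (2 * l - 5) / of_nat l" for w :: "nat \<Rightarrow> complex"
    have ReP: "Re (P w) > 0" if "w \<in> infinite_torus" for w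
    proof -
      have "norm (2 * w 0 / w i) = 2"
        using that by (simp add: infinite_torus_def norm_divide norm_mult)
      then have "Re (2 * w 0 / w i) \<le> 2" using complex_Re_le_cmod by metis
      then show ?thesis using l by (simp add: P_def)
    qed
    have ReQ: "Re (Q w) > 0" if "w \<in> infinite_torus" for w
    proof -
      have "norm (w i / w (2 * l - 5) / of_nat l) = 1 / real l"
        using that by (simp add: infinite_torus_def norm_divide norm_mult)
      then have "\<bar>Re (w i / w (2 * l - 5) / of_nat l)\<bar> \<le> 1 / real l"
        using abs_Re_le_cmod by metis
      moreover have "1 / real l < 1" using l by simp
      ultimately show ?thesis by (simp add: Q_def)
    qed
    have "continuous_on infinite_torus P"
      unfolding P_def using torus_nonzero by (intro continuous_intros continuous_on_coordinate) auto
    then have LnP: "continuous_on infinite_torus (\<lambda>w. Ln (P w))"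
      by (rule continuous_on_Ln') (use ReP in \<open>force simp: complex_nonpos_Reals_iff\<close>)
    have "continuous_on infinite_torus Q"
      unfolding Q_def using torus_nonzero l by (intro continuous_intros continuous_on_coordinate) auto
    then have LnQ: "continuous_on infinite_torus (\<lambda>w. Ln (Q w))"
      by (rule continuous_on_Ln') (use ReQ in \<open>force simp: complex_nonpos_Reals_iff\<close>)
    from LnP LnQ have "continuous_on infinite_torus (\<lambda>w. Ln (P w) - Ln (Q w))"
      by (rule continuous_on_diff)
    moreover have "orbits_out n w l - orbits_out n w 2
        = w i * exp (Ln (P w) - Ln (Q w)) * (orbits_in n w l - orbits_in n w 2)"
      if w: "w \<in> infinite_torus" for w
    proof -
      have "P w \<noteq> 0" "Q w \<noteq> 0" using ReP[OF w] ReQ[OF w] by auto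
      then have "w i * exp (Ln (P w) - Ln (Q w)) * Q w = w i * P w"
        by (simp add: exp_diff)
      also have "\<dots> = of_nat l * w i - 2 * w 0"
        using torus_nonzero[OF w, of i] by (simp add: P_def algebra_simps)
      finally show ?thesis
        using l by (simp add: orbits_out_def orbits_in_def Q_def add.commute)
    qed
    ultimately show ?thesis
      using l by (intro that[of 2 l "\<lambda>w. Ln (P w) - Ln (Q w)"]) auto
  qed
qed

lemma no_small_motion_planner:
  assumes k: "k \<le> 2 * n - 3"
  shows "\<not> has_motion_planner (top_of_set (Conf n :: (nat \<Rightarrow> complex) set)) k"
proof
  let ?S = "Conf n :: (nat \<Rightarrow> complex) set" and ?T = infinite_torus
  assume "has_motion_planner (top_of_set ?S) k"
  then obtain U where U: "\<And>i. i \<in> {1..k} \<Longrightarrow> openin (top_of_set (?S \<times> ?S)) (U i)"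
    and hom: "\<And>i. i \<in> {1..k} \<Longrightarrow> homotopic_with_canon (\<lambda>_. True) (U i) ?S fst snd"
    and cov: "?S \<times> ?S = (\<Union>i\<in>{1..k}. U i)"
    unfolding has_motion_planner_top_of_set by blast
  define f where "f w = (orbits_out n w, orbits_in n w)" for w
  have fcont: "continuous_on ?T f"
    unfolding f_def by (intro continuous_on_Pair continuous_on_orbits_out continuous_on_orbits_in)
  have fS: "f w \<in> ?S \<times> ?S" if "w \<in> ?T" for w
    using orbits_out_in_Conf orbits_in_in_Conf that by (simp add: f_def)
  \<comment> \<open>The cover is numbered from 1 and the torus coordinates from 0: coordinate
    \<open>i\<close> is assigned to the set \<open>U (Suc i)\<close>.\<close>
  have "\<exists>O'. open O' \<and> ?T \<inter> f -` U (Suc i) = ?T \<inter> O'" if "i < k" for i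
  proof -
    have "f \<in> ?T \<rightarrow> ?S \<times> ?S" using fS by blast
    moreover have "openin (top_of_set (?S \<times> ?S)) (U (Suc i))" using U that by simp
    ultimately have "openin (top_of_set ?T) (?T \<inter> f -` U (Suc i))"
      using fcont by (simp add: continuous_on_open_gen)
    then show ?thesis unfolding openin_open by blast
  qed
  then obtain O' where O': "\<And>i. i < k \<Longrightarrow> open (O' i)"
      "\<And>i. i < k \<Longrightarrow> ?T \<inter> f -` U (Suc i) = ?T \<inter> O' i"
    by metis
  have covT: "?T \<subseteq> (\<Union>i\<in>{..<k}. O' i)"
  proof
    fix w assume w: "w \<in> ?T"
    then obtain j where j: "j \<in> {1..k}" "f w \<in> U j" using fS cov by blast
    then have "j - 1 < k" "w \<in> ?T \<inter> f -` U (Suc (j - 1))" using w by auto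
    then show "w \<in> (\<Union>i\<in>{..<k}. O' i)" using O'(2) by blast
  qed
  \<comment> \<open>Compact pieces are wanted for the uniform subdivision in
    \<open>continuous_log_increment\<close>, closed ones for Tietze's theorem.\<close>
  have "\<exists>V. (\<forall>i<k. compact (V i) \<and> V i \<subseteq> ?T \<inter> O' i) \<and> ?T \<subseteq> (\<Union>i<k. V i)"
  proof (rule compact_shrinking[OF compact_infinite_torus _ covT])
    show "open (O' i)" if "i \<in> {..<k}" for i using O'(1) that by simp
  qed (use lessThan_iff in blast)
  then obtain V where V: "\<And>i. i < k \<Longrightarrow> compact (V i)" "\<And>i. i < k \<Longrightarrow> V i \<subseteq> ?T \<inter> O' i"
      "?T \<subseteq> (\<Union>i<k. V i)"
    by blast
  have "\<exists>\<eta>. continuous_on (V i) \<eta> \<and> (\<forall>w\<in>V i. w i = exp (\<eta> w))" if i: "i < k" for i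
  proof -
    have VU: "f w \<in> U (Suc i)" "w \<in> ?T" if "w \<in> V i" for w
      using V(2)[OF i] O'(2)[OF i] that by auto
    obtain a b \<psi> where ab: "a \<in> {1..n}" "b \<in> {1..n}" "a \<noteq> b" and \<psi>: "continuous_on ?T \<psi>"
      and eq: "\<And>w. w \<in> ?T \<Longrightarrow> orbits_out n w b - orbits_out n w a
            = w i * exp (\<psi> w) * (orbits_in n w b - orbits_in n w a)"
      using orbit_coordinate_logs[of i n] i k by (metis less_le_trans)
    have hom_i: "homotopic_with_canon (\<lambda>_. True) (U (Suc i)) ?S fst snd"
      using hom[of "Suc i"] i by simp
    obtain h where h: "continuous_on ({0..1::real} \<times> U (Suc i)) h"
      and hS: "\<forall>t\<in>{0..1::real}. \<forall>p\<in>U (Suc i). h (t, p) \<in> ?S"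
      and h0: "\<forall>p. h (0, p) = fst p" and h1: "\<forall>p. h (1, p) = snd p"
      using homotopic_with_canon_imp_ex[OF hom_i] by blast
    \<comment> \<open>The difference of the moving points \<open>b\<close> and \<open>a\<close>
      starts at the outer difference, ends at the inner one and never vanishes. Its logarithmic
      increment, together with \<open>\<psi>\<close>, gives a logarithm of
      \<open>w i\<close>.\<close>
    define z where "z = (\<lambda>(t, w). h (t, f w) b - h (t, f w) a)"
    have hf: "continuous_on ({0..1::real} \<times> V i) (\<lambda>p. h (fst p, f (snd p)))"
      using VU by (intro continuous_on_compose2[OF h] continuous_intros continuous_on_compose2[OF fcont]) auto
    have "continuous_on ({0..1} \<times> V i) z"
      unfolding z_def case_prod_unfold
      by (intro continuous_intros continuous_on_product_then_coordinatewise[OF hf])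
    moreover have "z (t, w) \<noteq> 0" if "t \<in> {0..1}" "w \<in> V i" for t w
    proof -
      have "inj_on (h (t, f w)) {1..n}"
        using hS[rule_format, OF that(1) VU(1)[OF that(2)]] by (simp add: Conf_def)
      from inj_on_eq_iff[OF this ab(2,1)] show ?thesis using ab(3) by (simp add: z_def)
    qed
    ultimately obtain \<Delta> where \<Delta>: "continuous_on (V i) \<Delta>"
      and z: "\<And>w. w \<in> V i \<Longrightarrow> z (1, w) = z (0, w) * exp (\<Delta> w)"
      using continuous_log_increment[OF V(1)[OF i]] by metis
    have "w i = exp (- \<psi> w - \<Delta> w)" if w: "w \<in> V i" for w
    proof -
      define d where "d = orbits_in n w b - orbits_in n w a"
      have "inj_on (orbits_in n w) {1..n}"
        using orbits_in_in_Conf[OF VU(2)[OF w], of n] by (simp add: Conf_def)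
      from inj_on_eq_iff[OF this ab(2,1)] have "d \<noteq> 0" using ab(3) by (simp add: d_def)
      moreover have "d = w i * exp (\<psi> w) * d * exp (\<Delta> w)"
        using z[OF w] eq[OF VU(2)[OF w]] by (simp add: z_def f_def h0 h1 d_def)
      ultimately have "w i * (exp (\<psi> w) * exp (\<Delta> w)) = 1"
        by (simp add: mult_ac)
      then show ?thesis
        by (simp add: exp_diff exp_minus field_simps)
    qed
    moreover have "continuous_on (V i) (\<lambda>w. - \<psi> w - \<Delta> w)"
      using VU by (intro continuous_intros \<Delta> continuous_on_subset[OF \<psi>]) auto
    ultimately show ?thesis by blast
  qed
  then obtain \<eta> where \<eta>: "\<And>i. i < k \<Longrightarrow> continuous_on (V i) (\<eta> i)"
      "\<And>i w. i < k \<Longrightarrow> w \<in> V i \<Longrightarrow> w i = exp (\<eta> i w)"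
    by metis
  show False
  proof (rule no_coordinate_logs_on_torus[OF _ _ V(3) \<eta>])
    show "closed (V i)" if "i < k" for i using V(1)[OF that] by (rule compact_imp_closed)
    show "V i \<subseteq> ?T" if "i < k" for i using V(2)[OF that] by blast
  qed
qed

section \<open>The upper bound\<close>

lemma continuous_on_locally_constant:
  assumes "\<And>x. x \<in> S \<Longrightarrow> \<exists>N. open N \<and> x \<in> N \<and> (\<forall>y\<in>N \<inter> S. f y = f x)"
  shows "continuous_on S f"
  unfolding continuous_on_topological using assms by (metis IntI)

text \<open>Tietze's theorem extends the motion coordinate by coordinate, at the risk of collisions.
  The pairs in \<open>W\<close> over which a collision occurs form a closed set, because time is
  compact, and this set misses \<open>E\<close>; its complement in \<open>W\<close> is the required
  \<open>U\<close>.\<close>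

lemma thicken_motion_planner:
  fixes n :: nat
  defines "S \<equiv> Conf n :: (nat \<Rightarrow> complex) set"
  assumes W: "openin (top_of_set (S \<times> S)) W" and E: "closedin (top_of_set W) E"
    and hom: "homotopic_with_canon (\<lambda>_. True) E S fst snd"
  shows "\<exists>U. openin (top_of_set (S \<times> S)) U \<and> E \<subseteq> U \<and> homotopic_with_canon (\<lambda>_. True) U S fst snd"
proof -
  have WS: "W \<subseteq> S \<times> S" using W openin_imp_subset by blast
  have EW: "E \<subseteq> W" using E closedin_imp_subset by blast
  obtain h where h: "continuous_on ({0..1::real} \<times> E) h"
      and hS: "\<forall>t\<in>{0..1}. \<forall>p\<in>E. h (t, p) \<in> S"
      and h0: "\<forall>p. h (0, p) = fst p" and h1: "\<forall>p. h (1, p) = snd p"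
    using homotopic_with_canon_imp_ex[OF hom] by blast
  \<comment> \<open>Including both ends over all of \<open>W\<close> makes the extended motion start
    and finish at the right configurations outside \<open>E\<close> as well.\<close>
  define D where "D = {0..1::real} \<times> E \<union> ({0} \<times> W \<union> {1} \<times> W)"
  define f where "f = (\<lambda>(t::real, p). if t = 0 then fst p else if t = 1 then snd p else h (t, p))"
  have cl: "closedin (top_of_set ({0..1} \<times> W)) ({0..1} \<times> E)"
      "closedin (top_of_set ({0..1::real} \<times> W)) ({0} \<times> W)"
      "closedin (top_of_set ({0..1::real} \<times> W)) ({1} \<times> W)"
    using E by (auto intro!: closedin_Times simp: closed_subset)
  have Dsub: "D \<subseteq> {0..1} \<times> W" using EW by (auto simp: D_def)
  have D: "closedin (top_of_set ({0..1} \<times> W)) D"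
    unfolding D_def using cl by (intro closedin_Un)
  have fD: "continuous_on D f"
    unfolding D_def
  proof (intro continuous_on_Un_local)
    show "continuous_on ({0..1} \<times> E) f"
      using h by (rule continuous_on_eq) (auto simp: f_def h0 h1)
    have "continuous_on ({0} \<times> W) (\<lambda>x. fst (snd x))" by (intro continuous_intros)
    then show "continuous_on ({0} \<times> W) f"
      by (rule continuous_on_eq) (auto simp: f_def)
    have "continuous_on ({1} \<times> W) (\<lambda>x. snd (snd x))" by (intro continuous_intros)
    then show "continuous_on ({1} \<times> W) f"
      by (rule continuous_on_eq) (auto simp: f_def)
    show "closedin (top_of_set ({0::real} \<times> W \<union> {1} \<times> W)) ({0::real} \<times> W)"
      by (rule closedin_subset_trans[OF cl(2)]) auto
    show "closedin (top_of_set ({0::real} \<times> W \<union> {1} \<times> W)) ({1} \<times> W)"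
      by (rule closedin_subset_trans[OF cl(3)]) auto
    have "closedin (top_of_set ({0..1::real} \<times> W)) ({0::real} \<times> W \<union> {1} \<times> W)"
      using cl by (intro closedin_Un)
    then show "closedin (top_of_set ({0..1::real} \<times> E \<union> ({0::real} \<times> W \<union> {1} \<times> W))) ({0::real} \<times> W \<union> {1} \<times> W)"
      by (rule closedin_subset_trans) (use Dsub D_def in auto)
    show "closedin (top_of_set ({0..1::real} \<times> E \<union> ({0::real} \<times> W \<union> {1} \<times> W))) ({0..1::real} \<times> E)"
      by (rule closedin_subset_trans[OF cl(1)]) (use Dsub D_def in auto)
  qed
  have "\<exists>g. continuous_on ({0..1} \<times> W) g \<and> (\<forall>x\<in>D. g x = f x i)" for i
    using Tietze_unbounded[OF continuous_on_product_then_coordinatewise[OF fD] D] by metis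
  then obtain g where g: "\<And>i. continuous_on ({0..1} \<times> W) (g i)"
    and gD: "\<And>i x. x \<in> D \<Longrightarrow> g i x = f x i" by metis
  define Bad where "Bad = (\<Union>(i, j)\<in>{(i, j). i \<in> {1..n} \<and> j \<in> {1..n} \<and> i \<noteq> j}. {x \<in> {0..1} \<times> W. g i x = g j x})"
  have "closedin (top_of_set ({0..1} \<times> W)) {x \<in> {0..1} \<times> W. g i x = g j x}" for i j
  proof -
    have "continuous_on ({0..1} \<times> W) (\<lambda>x. g i x - g j x)" by (intro continuous_intros g)
    from continuous_closedin_preimage_constant[OF this, of 0] show ?thesis by simp
  qed
  moreover have "finite {(i, j). i \<in> {1..n} \<and> j \<in> {1..n} \<and> i \<noteq> j}"
    by (rule finite_subset[of _ "{1..n} \<times> {1..n}"]) auto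
  ultimately have "closedin (top_of_set ({0..1} \<times> W)) Bad"
    unfolding Bad_def by (intro closedin_Union finite_imageI) auto
  \<comment> \<open>The projection along the compact interval is a closed map.\<close>
  then have "closedin (top_of_set W) (snd ` Bad)"
    using Abstract_Topological_Spaces.closed_map_snd[of "top_of_set {0..1::real}" "top_of_set W"]
    by (simp add: closed_map_def compact_space_subtopology)
  then have "openin (top_of_set W) (W - snd ` Bad)"
    by (simp add: openin_diff)
  then have op: "openin (top_of_set (S \<times> S)) (W - snd ` Bad)"
    using W openin_trans by blast
  have EU: "E \<subseteq> W - snd ` Bad"
  proof -
    have nb: "(t, p) \<notin> Bad" if "p \<in> E" for t p
    proof
      assume "(t, p) \<in> Bad"
      then obtain i j where ij: "i \<in> {1..n}" "j \<in> {1..n}" "i \<noteq> j" and t: "t \<in> {0..1}"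
        and eq: "g i (t, p) = g j (t, p)" by (auto simp: Bad_def)
      have "h (t, p) \<in> S" by (rule hS[rule_format, OF t that])
      moreover have "f (t, p) = h (t, p)" by (simp add: f_def h0 h1)
      moreover have "(t, p) \<in> D" using t that by (simp add: D_def)
      ultimately have "inj_on (\<lambda>i. g i (t, p)) {1..n}"
        using gD by (simp add: S_def Conf_def)
      from inj_on_eq_iff[OF this ij(1,2)] show False using ij(3) eq by simp
    qed
    show ?thesis
    proof
      fix p assume p: "p \<in> E"
      then have "p \<notin> snd ` Bad" using nb[OF p] by (metis imageE prod.collapse)
      then show "p \<in> W - snd ` Bad" using p EW by blast
    qed
  qed
  have "homotopic_with_canon (\<lambda>_. True) (W - snd ` Bad) S fst snd"
    unfolding homotopic_with[of "top_of_set (W - snd ` Bad)" "\<lambda>_. True", OF refl]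
  proof (intro exI conjI ballI)
    let ?H = "\<lambda>x. restrict (\<lambda>i. g i x) {1..n}"
    have "continuous_on ({0..1} \<times> (W - snd ` Bad)) ?H"
    proof (rule continuous_on_coordinatewise_then_product)
      show "continuous_on ({0..1} \<times> (W - snd ` Bad)) (\<lambda>x. ?H x i)" for i
        by (cases "i \<in> {1..n}") (auto intro: continuous_on_subset[OF g])
    qed
    moreover have "?H (t, p) \<in> S" if "t \<in> {0..1}" "p \<in> W - snd ` Bad" for t p
    proof -
      have "(t, p) \<notin> Bad" using that by (metis DiffD2 image_eqI snd_conv)
      then have "inj_on (\<lambda>i. g i (t, p)) {1..n}"
        using that by (intro inj_onI) (auto simp: Bad_def)
      then show ?thesis by (simp add: S_def Conf_def)
    qed
    ultimately show "continuous_map (prod_topology (top_of_set {0..1}) (top_of_set (W - snd ` Bad)))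
        (top_of_set S) ?H"
      by (auto simp: image_subset_iff)
    fix p assume "p \<in> topspace (top_of_set (W - snd ` Bad))"
    then have p: "p \<in> W" "fst p \<in> extensional {1..n}" "snd p \<in> extensional {1..n}"
      using WS by (auto simp: S_def Conf_def)
    then have "(0, p) \<in> D" "(1, p) \<in> D" by (auto simp: D_def)
    then show "?H (0, p) = fst p" "?H (1, p) = snd p"
      using gD p by (auto simp: f_def fun_eq_iff extensional_def)
  qed auto
  then show ?thesis using op EU by blast
qed

section \<open>Motions along parabolas\<close>

text \<open>
  The parabolas serve as a one-parameter family of paths from \<open>0\<close> to \<open>1\<close> in the complex plane that sweep
  out every point with real part in \<open>(0, 1)\<close> just once, so all but finitely many of
  them avoid a given finite set.
\<close>

definition parabola :: "real \<Rightarrow> real \<Rightarrow> complex" where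
  "parabola \<kappa> t = Complex t (\<kappa> * t * (1 - t))"

text \<open>All points move by the same complex affine parameter, which follows a parabola instead
  of the real segment. With \<open>\<kappa> = 0\<close> this is the straight-line homotopy, so one
  form covers every stage of the motion.\<close>

lemma homotopic_along_parabolas:
  fixes a b :: "'c::topological_space \<Rightarrow> nat \<Rightarrow> complex"
  assumes cont: "continuous_on E a" "continuous_on E b" "continuous_on E \<kappa>"
    and ext: "\<And>q. q \<in> E \<Longrightarrow> a q \<in> extensional {1..n}" "\<And>q. q \<in> E \<Longrightarrow> b q \<in> extensional {1..n}"
    and inj: "\<And>q t. q \<in> E \<Longrightarrow> t \<in> {0..1} \<Longrightarrow>
      inj_on (\<lambda>i. (1 - parabola (\<kappa> q) t) * a q i + parabola (\<kappa> q) t * b q i) {1..n}"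
  shows "homotopic_with_canon (\<lambda>_. True) E (Conf n) a b"
  unfolding homotopic_with[of "top_of_set E" "\<lambda>_. True", OF refl]
proof (intro exI conjI ballI)
  define H where "H x = (\<lambda>i\<in>{1..n}.
      (1 - parabola (\<kappa> (snd x)) (fst x)) * a (snd x) i
      + parabola (\<kappa> (snd x)) (fst x) * b (snd x) i)" for x
  have c: "continuous_on ({0..1::real} \<times> E) (\<lambda>x. a (snd x) i)" "continuous_on ({0..1::real} \<times> E) (\<lambda>x. b (snd x) i)"
    "continuous_on ({0..1::real} \<times> E) (\<lambda>x. \<kappa> (snd x))" for i
    by (rule continuous_on_product_then_coordinatewise, rule continuous_on_compose2[OF cont(1)], auto intro!: continuous_intros)
       (rule continuous_on_product_then_coordinatewise, rule continuous_on_compose2[OF cont(2)], auto intro!: continuous_intros,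
        rule continuous_on_compose2[OF cont(3)], auto intro!: continuous_intros)
  have "continuous_on ({0..1} \<times> E) (\<lambda>x. H x i)" for i
    by (cases "i \<in> {1..n}") (auto simp: H_def parabola_def Complex_eq intro!: continuous_intros c)
  then have "continuous_on ({0..1} \<times> E) H"
    by (rule continuous_on_coordinatewise_then_product)
  moreover have "H (t, q) \<in> Conf n" if "t \<in> {0..1}" "q \<in> E" for t q
    using inj[OF that(2,1)] by (simp add: H_def Conf_def)
  ultimately show "continuous_map (prod_topology (top_of_set {0..1}) (top_of_set E)) (top_of_set (Conf n)) H"
    by (auto simp: image_subset_iff)
  show "H (0, q) = a q" "H (1, q) = b q" if "q \<in> topspace (top_of_set E)" for q
    using ext[of q] that by (auto simp: H_def fun_eq_iff extensional_def parabola_def Complex_eq)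
qed auto

text \<open>Two of the points coincide for at most one complex parameter, \<open>root i j\<close>,
  and not at the ends 0 and 1. Hence finitely many values of \<open>\<kappa>\<close> have to be
  avoided.\<close>

lemma ex_injective_parabola:
  fixes z z' :: "nat \<Rightarrow> complex"
  assumes z: "inj_on z I" "inj_on z' I" and I: "finite I"
  shows "\<exists>\<kappa>. \<forall>t\<in>{0..1}. inj_on (\<lambda>i. (1 - parabola \<kappa> t) * z i + parabola \<kappa> t * z' i) I"
proof -
  define root where "root i j = (z i - z j) / ((z i - z j) - (z' i - z' j))" for i j
  \<comment> \<open>This is the equation of the parabola solved for \<open>\<kappa>\<close> at the
    root. A root with real part 0 or 1 contributes the default value 0 of a division by zero; it
    could only be met at the ends of the path.\<close>
  define bad where "bad = (\<lambda>(i, j). Im (root i j) / (Re (root i j) * (1 - Re (root i j)))) ` (I \<times> I)"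
  have "finite bad" using I by (simp add: bad_def)
  then obtain \<kappa> where \<kappa>: "\<kappa> \<notin> bad"
    using ex_new_if_finite infinite_UNIV_char_0 by blast
  have "(1 - \<zeta>) * z i + \<zeta> * z' i \<noteq> (1 - \<zeta>) * z j + \<zeta> * z' j"
    if t: "t \<in> {0..1}" and ij: "i \<in> I" "j \<in> I" "i \<noteq> j" and \<zeta>: "\<zeta> = parabola \<kappa> t" for t i j \<zeta>
  proof
    assume eq: "(1 - \<zeta>) * z i + \<zeta> * z' i = (1 - \<zeta>) * z j + \<zeta> * z' j"
    have d: "z i \<noteq> z j" "z' i \<noteq> z' j" using z ij by (auto simp: inj_on_def)
    have e: "\<zeta> * ((z i - z j) - (z' i - z' j)) = z i - z j"
      using eq by (simp add: algebra_simps)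
    then have "(z i - z j) - (z' i - z' j) \<noteq> 0" using d(1) by auto
    then have r: "\<zeta> = root i j" using e by (simp add: root_def field_simps)
    have "t \<noteq> 0"
    proof
      assume "t = 0"
      then have "\<zeta> = 0" by (simp add: \<zeta> parabola_def complex_eq_iff)
      then show False using eq d by simp
    qed
    moreover have "t \<noteq> 1"
    proof
      assume "t = 1"
      then have "\<zeta> = 1" by (simp add: \<zeta> parabola_def complex_eq_iff)
      then show False using eq d by simp
    qed
    ultimately have "\<kappa> = Im (root i j) / (Re (root i j) * (1 - Re (root i j)))"
      by (simp add: r[symmetric] \<zeta> parabola_def)
    then have "\<kappa> \<in> bad" using ij unfolding bad_def by force
    then show False using \<kappa> by blast
  qed
  then show ?thesis
    by (intro exI[of _ \<kappa>] ballI inj_onI) (rule ccontr, blast)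
qed

section \<open>Convexity of cells and semicontinuity of the rank\<close>

text \<open>The fibres of \<open>lex_pattern\<close> are the Fox-Neuwirth cells.\<close>

definition re_rank :: "nat \<Rightarrow> (nat \<Rightarrow> complex) \<Rightarrow> nat" where
  "re_rank n z = card ((\<lambda>i. Re (z i)) ` {1..n})"

definition lex_pattern :: "nat \<Rightarrow> (nat \<Rightarrow> complex) \<Rightarrow> (nat \<times> nat) set \<times> (nat \<times> nat) set" where
  "lex_pattern n z =
     ({(i, j). i \<in> {1..n} \<and> j \<in> {1..n} \<and> Re (z i) < Re (z j)},
      {(i, j). i \<in> {1..n} \<and> j \<in> {1..n} \<and> Re (z i) = Re (z j) \<and> Im (z i) < Im (z j)})"

lemma lex_pattern_eqD:
  assumes "lex_pattern n z = lex_pattern n z'" "i \<in> {1..n}" "j \<in> {1..n}"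
  shows "Re (z i) < Re (z j) \<longleftrightarrow> Re (z' i) < Re (z' j)"
    and "Re (z i) = Re (z j) \<and> Im (z i) < Im (z j) \<longleftrightarrow> Re (z' i) = Re (z' j) \<and> Im (z' i) < Im (z' j)"
  using assms unfolding lex_pattern_def prod.inject set_eq_iff by blast+

lemma convex_combination_less:
  fixes a b c d t :: real
  assumes "a < b" "c < d" "0 \<le> t" "t \<le> 1"
  shows "(1 - t) * a + t * c < (1 - t) * b + t * d"
proof (cases "t = 0")
  case False
  then have "t * c < t * d" using assms by simp
  moreover have "(1 - t) * a \<le> (1 - t) * b" using assms by (intro mult_left_mono) auto
  ultimately show ?thesis by linarith
qed (use assms in simp)

text \<open>Distinct points are strictly ordered by real part or, in case of a tie, by imaginary
  part. Equal patterns mean the same strict inequalities at both ends, and these pass to convex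
  combinations.\<close>

lemma inj_on_segment_of_lex_pattern_eq:
  assumes pat: "lex_pattern n z = lex_pattern n z'" and inj: "inj_on z {1..n}" and t: "t \<in> {0..1}"
  shows "inj_on (\<lambda>i. (1 - of_real t) * z i + of_real t * z' i) {1..n}"
proof (rule inj_onI, rule ccontr)
  fix i j assume ij: "i \<in> {1..n}" "j \<in> {1..n}" and ne: "i \<noteq> j"
    and eq: "(1 - of_real t) * z i + of_real t * z' i = (1 - of_real t) * z j + of_real t * z' j"
  have re: "(1 - t) * Re (z i) + t * Re (z' i) = (1 - t) * Re (z j) + t * Re (z' j)"
    using arg_cong[OF eq, of Re] by simp
  have im: "(1 - t) * Im (z i) + t * Im (z' i) = (1 - t) * Im (z j) + t * Im (z' j)"
    using arg_cong[OF eq, of Im] by simp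
  have t01: "0 \<le> t" "t \<le> 1" using t by auto
  have noless: False if "k \<in> {1..n}" "l \<in> {1..n}"
      "(1 - t) * Re (z k) + t * Re (z' k) = (1 - t) * Re (z l) + t * Re (z' l)" "Re (z k) < Re (z l)" for k l
    using convex_combination_less[OF that(4) _ t01, of "Re (z' k)" "Re (z' l)"]
      lex_pattern_eqD(1)[OF pat that(1,2)] that(3,4) by simp
  have "Re (z i) = Re (z j)"
    using noless[OF ij re] noless[OF ij(2,1) re[symmetric]] by (meson linorder_neqE_linordered_idom)
  moreover have "z i \<noteq> z j" using inj_on_eq_iff[OF inj ij] ne by simp
  ultimately have "Im (z i) < Im (z j) \<or> Im (z j) < Im (z i)"
    by (auto simp: complex_eq_iff)
  then show False
  proof
    assume less: "Im (z i) < Im (z j)"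
    then have "Im (z' i) < Im (z' j)"
      using lex_pattern_eqD(2)[OF pat ij] \<open>Re (z i) = Re (z j)\<close> by simp
    from convex_combination_less[OF less this t01] im show False by simp
  next
    assume less: "Im (z j) < Im (z i)"
    then have "Im (z' j) < Im (z' i)"
      using lex_pattern_eqD(2)[OF pat ij(2,1)] \<open>Re (z i) = Re (z j)\<close> by simp
    from convex_combination_less[OF less this t01] im show False by simp
  qed
qed

text \<open>Strict inequalities persist nearby, so ties between real parts can break but not arise,
  and the rank cannot drop. If the rank is unchanged, no tie has broken and all order relations
  agree.\<close>

lemma re_rank_semicontinuous:
  assumes inj: "inj_on z {1..n}"
  shows "\<exists>N. open N \<and> z \<in> N \<and> (\<forall>z'\<in>N. re_rank n z \<le> re_rank n z' \<and>
           (re_rank n z' = re_rank n z \<longrightarrow> lex_pattern n z' = lex_pattern n z))"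
proof -
  let ?I = "{1..n}"
  define N where "N = (\<Inter>i\<in>?I. \<Inter>j\<in>?I.
      {z'. Re (z i) < Re (z j) \<longrightarrow> Re (z' i) < Re (z' j)} \<inter> {z'. Im (z i) < Im (z j) \<longrightarrow> Im (z' i) < Im (z' j)})"
  have op: "open {z' :: nat \<Rightarrow> complex. Re (z' i) < Re (z' j)}" "open {z' :: nat \<Rightarrow> complex. Im (z' i) < Im (z' j)}" for i j
    by (intro open_Collect_less continuous_intros continuous_on_product_then_coordinatewise[OF continuous_on_id])+
  have "open {z' :: nat \<Rightarrow> complex. P \<longrightarrow> Re (z' i) < Re (z' j)}"
    "open {z' :: nat \<Rightarrow> complex. P \<longrightarrow> Im (z' i) < Im (z' j)}" for P i j
    using op[of i j] by (cases P; simp)+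
  then have "open N" unfolding N_def by (intro open_INT ballI open_Int) auto
  moreover have "z \<in> N" by (simp add: N_def)
  moreover have "re_rank n z \<le> re_rank n z' \<and>
      (re_rank n z' = re_rank n z \<longrightarrow> lex_pattern n z' = lex_pattern n z)" if z': "z' \<in> N" for z'
  proof -
    have re: "Re (z' i) < Re (z' j)" if "i \<in> ?I" "j \<in> ?I" "Re (z i) < Re (z j)" for i j
      using z' that by (auto simp: N_def)
    have im: "Im (z' i) < Im (z' j)" if "i \<in> ?I" "j \<in> ?I" "Im (z i) < Im (z j)" for i j
      using z' that by (auto simp: N_def)
    have ties: "Re (z i) = Re (z j)" if "i \<in> ?I" "j \<in> ?I" "Re (z' i) = Re (z' j)" for i j
      using re[OF that(1,2)] re[OF that(2,1)] that(3) by (metis less_irrefl linorder_neqE_linordered_idom)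
    \<comment> \<open>By \<open>ties\<close>, the value does not depend on the index chosen. Thus
      \<open>\<phi>\<close> maps the real parts of \<open>z'\<close> onto those of \<open>z\<close>,
      and equal cardinalities make it injective.\<close>
    define \<phi> where "\<phi> v = Re (z (SOME i. i \<in> ?I \<and> Re (z' i) = v))" for v
    have \<phi>: "\<phi> (Re (z' i)) = Re (z i)" if "i \<in> ?I" for i
    proof -
      have "(SOME k. k \<in> ?I \<and> Re (z' k) = Re (z' i)) \<in> ?I \<and>
          Re (z' (SOME k. k \<in> ?I \<and> Re (z' k) = Re (z' i))) = Re (z' i)"
        by (rule someI[of _ i]) (use that in blast)
      then show ?thesis unfolding \<phi>_def using ties that by blast
    qed
    let ?A = "(\<lambda>i. Re (z i)) ` ?I" and ?A' = "(\<lambda>i. Re (z' i)) ` ?I"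
    have img: "?A = \<phi> ` ?A'" using \<phi> by (simp add: image_image)
    have "card ?A \<le> card ?A'" unfolding img by (intro card_image_le) simp
    moreover have "lex_pattern n z' = lex_pattern n z" if "card ?A' = card ?A"
    proof -
      have "inj_on \<phi> ?A'" using that img by (intro eq_card_imp_inj_on) auto
      then have ties': "Re (z' i) = Re (z' j)" if "i \<in> ?I" "j \<in> ?I" "Re (z i) = Re (z j)" for i j
        using \<phi>[OF that(1)] \<phi>[OF that(2)] that by (metis imageI inj_onD)
      have "Re (z' i) < Re (z' j) \<longleftrightarrow> Re (z i) < Re (z j)" if ij: "i \<in> ?I" "j \<in> ?I" for i j
        using re[OF ij] re[OF ij(2,1)] ties'[OF ij] by (metis less_irrefl less_asym linorder_neqE_linordered_idom)
      moreover have "Re (z' i) = Re (z' j) \<and> Im (z' i) < Im (z' j) \<longleftrightarrow> Re (z i) = Re (z j) \<and> Im (z i) < Im (z j)"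
        if ij: "i \<in> ?I" "j \<in> ?I" for i j
      proof (cases "Re (z i) = Re (z j) \<and> i \<noteq> j")
        case True
        then have "z i \<noteq> z j" using inj_on_eq_iff[OF inj ij] by simp
        then have "Im (z i) \<noteq> Im (z j)" using True by (simp add: complex_eq_iff)
        then show ?thesis
          using ties'[OF ij] True im[OF ij] im[OF ij(2,1)] by (metis less_asym linorder_neqE_linordered_idom)
      next
        case False
        then show ?thesis using ties[OF ij] by auto
      qed
      ultimately show ?thesis
        unfolding lex_pattern_def by (intro arg_cong2[of _ _ _ _ Pair] Collect_cong) auto
    qed
    ultimately show ?thesis by (simp add: re_rank_def)
  qed
  ultimately show ?thesis by blast
qed

section \<open>Splitting a configuration into frame and shape\<close>

definition scale :: "nat \<Rightarrow> complex \<Rightarrow> (nat \<Rightarrow> complex) \<Rightarrow> nat \<Rightarrow> complex" where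
  "scale n c z = (\<lambda>i\<in>{1..n}. c * z i)"

lemma inj_on_mult_left:
  fixes f :: "'i \<Rightarrow> complex"
  shows "c \<noteq> 0 \<Longrightarrow> inj_on f I \<Longrightarrow> inj_on (\<lambda>i. c * f i) I"
  by (rule inj_onI) (simp add: inj_on_eq_iff)

lemma scale_in_Conf: "c \<noteq> 0 \<Longrightarrow> z \<in> Conf n \<Longrightarrow> scale n c z \<in> Conf n"
  by (simp add: scale_def Conf_def inj_on_mult_left)

definition frame :: "(nat \<Rightarrow> complex) \<Rightarrow> complex" where
  "frame x = x 2 - x 1"

text \<open>The configuration is rotated and dilated, not translated. For \<open>n \<ge> 2\<close>,
  \<open>frame\<close> and \<open>shape\<close> are the two factors of the product decomposition of
  \<open>Conf n\<close>.\<close>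

definition shape :: "nat \<Rightarrow> (nat \<Rightarrow> complex) \<Rightarrow> nat \<Rightarrow> complex" where
  "shape n x = scale n (1 / frame x) x"

lemma frame_nonzero: "n \<ge> 2 \<Longrightarrow> x \<in> Conf n \<Longrightarrow> frame x \<noteq> 0"
  using inj_on_eq_iff[of x "{1..n}" 2 1] by (auto simp: Conf_def frame_def)

lemma shape_in_Conf: "n \<ge> 2 \<Longrightarrow> x \<in> Conf n \<Longrightarrow> shape n x \<in> Conf n"
  by (simp add: shape_def scale_in_Conf frame_nonzero)

lemma scale_frame_shape: "n \<ge> 2 \<Longrightarrow> x \<in> Conf n \<Longrightarrow> scale n (frame x) (shape n x) = x"
  using frame_nonzero[of n x]
  by (auto simp: scale_def shape_def fun_eq_iff Conf_def extensional_def)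

text \<open>In a shape the second point is the first one plus 1, which forces two different real
  parts. Excluding rank 1 brings the number of strata down to \<open>2 * n - 2\<close>.\<close>

lemma re_rank_shape_bounds:
  assumes "n \<ge> 2" "x \<in> Conf n"
  shows "2 \<le> re_rank n (shape n x)" "re_rank n (shape n x) \<le> n"
proof -
  have "shape n x 2 - shape n x 1 = (x 2 - x 1) / frame x"
    using assms(1) by (simp add: shape_def scale_def diff_divide_distrib)
  then have "shape n x 2 - shape n x 1 = 1"
    using frame_nonzero[OF assms] unfolding frame_def[symmetric] by simp
  then have "Re (shape n x 2) - Re (shape n x 1) = 1"
    by (metis minus_complex.simps(1) one_complex.simps(1))
  then have "Re (shape n x 1) \<noteq> Re (shape n x 2)" by linarith
  then have "card {Re (shape n x 1), Re (shape n x 2)} = 2" by simp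
  moreover have "{Re (shape n x 1), Re (shape n x 2)} \<subseteq> (\<lambda>i. Re (shape n x i)) ` {1..n}"
    using assms by auto
  ultimately show "2 \<le> re_rank n (shape n x)"
    unfolding re_rank_def by (metis card_mono finite_atLeastAtMost finite_imageI)
  show "re_rank n (shape n x) \<le> n"
    unfolding re_rank_def using card_image_le[of "{1..n}" "\<lambda>i. Re (shape n x i)"] by simp
qed

lemma continuous_on_frame: "continuous_on S frame"
  unfolding frame_def[abs_def] by (intro continuous_intros continuous_on_coordinate)

lemma continuous_on_scale:
  assumes "continuous_on E c" "continuous_on E f"
  shows "continuous_on E (\<lambda>p. scale n (c p) (f p))"
  unfolding scale_def
  by (intro continuous_on_restrict continuous_intros assms continuous_on_product_then_coordinatewise[OF assms(2)])

lemma continuous_on_shape: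
  assumes n: "n \<ge> 2"
  shows "continuous_on (Conf n) (shape n)"
  unfolding shape_def[abs_def] using frame_nonzero[OF n]
  by (intro continuous_on_scale continuous_on_divide continuous_on_const continuous_on_id continuous_on_frame) auto

section \<open>Strata of pairs of configurations and motions over them\<close>

definition stratum_index :: "nat \<Rightarrow> (nat \<Rightarrow> complex) \<times> (nat \<Rightarrow> complex) \<Rightarrow> nat" where
  "stratum_index n p = re_rank n (shape n (fst p)) + re_rank n (shape n (snd p)) +
     (if frame (snd p) / frame (fst p) \<in> \<real>\<^sub>\<le>\<^sub>0 then 0 else 1)"

text \<open>The discrete data by which the motion over a stratum is chosen.\<close>

definition cell_type where
  "cell_type n p = (lex_pattern n (shape n (fst p)), lex_pattern n (shape n (snd p)),
     frame (snd p) / frame (fst p) \<in> \<real>\<^sub>\<le>\<^sub>0)"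

text \<open>None of the three summands can drop nearby: the ranks by
  \<open>re_rank_semicontinuous\<close>, the last one because opposite frames form a closed
  condition. If the sum is unchanged, so is each summand, and with the ranks the cells.\<close>

lemma stratum_index_semicontinuous:
  assumes n: "n \<ge> 2" and p: "p \<in> Conf n \<times> Conf n"
  shows "\<exists>N. open N \<and> p \<in> N \<and> (\<forall>q\<in>N \<inter> (Conf n \<times> Conf n). stratum_index n p \<le> stratum_index n q \<and>
           (stratum_index n q = stratum_index n p \<longrightarrow> cell_type n q = cell_type n p))"
proof -
  let ?S = "Conf n :: (nat \<Rightarrow> complex) set"
  have *: "\<exists>N. open N \<and> p \<in> N \<and> (\<forall>q\<in>N \<inter> (?S \<times> ?S).
      re_rank n (shape n (f p)) \<le> re_rank n (shape n (f q)) \<and>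
      (re_rank n (shape n (f q)) = re_rank n (shape n (f p)) \<longrightarrow>
        lex_pattern n (shape n (f q)) = lex_pattern n (shape n (f p))))"
    if f: "continuous_on (?S \<times> ?S) f" "f ` (?S \<times> ?S) \<subseteq> ?S" for f
  proof -
    have "inj_on (shape n (f p)) {1..n}"
      using shape_in_Conf[OF n] f(2) p by (auto simp: Conf_def)
    from re_rank_semicontinuous[OF this] obtain B where B: "open B" "shape n (f p) \<in> B"
      "\<forall>z'\<in>B. re_rank n (shape n (f p)) \<le> re_rank n z' \<and>
         (re_rank n z' = re_rank n (shape n (f p)) \<longrightarrow> lex_pattern n z' = lex_pattern n (shape n (f p)))"
      by blast
    have "continuous_on (?S \<times> ?S) (\<lambda>q. shape n (f q))"
      by (rule continuous_on_compose2[OF continuous_on_shape[OF n] f])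
    then obtain A where "open A" "p \<in> A" "\<forall>q\<in>?S \<times> ?S. q \<in> A \<longrightarrow> shape n (f q) \<in> B"
      using p B(1,2) unfolding continuous_on_topological by blast
    then show ?thesis using B(3) by (intro exI[of _ A]) blast
  qed
  obtain N1 where N1: "open N1" "p \<in> N1" "\<forall>q\<in>N1 \<inter> (?S \<times> ?S).
      re_rank n (shape n (fst p)) \<le> re_rank n (shape n (fst q)) \<and>
      (re_rank n (shape n (fst q)) = re_rank n (shape n (fst p)) \<longrightarrow>
        lex_pattern n (shape n (fst q)) = lex_pattern n (shape n (fst p)))"
    using *[of fst] by (force intro: continuous_intros)
  obtain N2 where N2: "open N2" "p \<in> N2" "\<forall>q\<in>N2 \<inter> (?S \<times> ?S).
      re_rank n (shape n (snd p)) \<le> re_rank n (shape n (snd q)) \<and>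
      (re_rank n (shape n (snd q)) = re_rank n (shape n (snd p)) \<longrightarrow>
        lex_pattern n (shape n (snd q)) = lex_pattern n (shape n (snd p)))"
    using *[of snd] by (force intro: continuous_intros)
  obtain N3 where N3: "open N3" "p \<in> N3" "\<forall>q\<in>N3 \<inter> (?S \<times> ?S).
      frame (snd q) / frame (fst q) \<in> \<real>\<^sub>\<le>\<^sub>0 \<longrightarrow> frame (snd p) / frame (fst p) \<in> \<real>\<^sub>\<le>\<^sub>0"
  proof (cases "frame (snd p) / frame (fst p) \<in> \<real>\<^sub>\<le>\<^sub>0")
    case True
    then show ?thesis using that[of UNIV] by simp
  next
    case False
    have "continuous_on (?S \<times> ?S) (\<lambda>q. frame (snd q) / frame (fst q))"
      using frame_nonzero[OF n]
      by (intro continuous_on_divide continuous_on_compose2[OF continuous_on_frame[of UNIV]] continuous_intros) auto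
    moreover have "open (- \<real>\<^sub>\<le>\<^sub>0 :: complex set)" by (simp add: open_Compl)
    ultimately obtain A where "open A" "p \<in> A"
        "\<forall>q\<in>?S \<times> ?S. q \<in> A \<longrightarrow> frame (snd q) / frame (fst q) \<in> - \<real>\<^sub>\<le>\<^sub>0"
      using p False unfolding continuous_on_topological by (metis ComplI)
    then show ?thesis using that[of A] by blast
  qed
  have "stratum_index n p \<le> stratum_index n q \<and>
           (stratum_index n q = stratum_index n p \<longrightarrow> cell_type n q = cell_type n p)"
    if q: "q \<in> N1 \<inter> N2 \<inter> N3 \<inter> (?S \<times> ?S)" for q
  proof -
    have q1: "q \<in> N1 \<inter> (?S \<times> ?S)" and q2: "q \<in> N2 \<inter> (?S \<times> ?S)" and q3: "q \<in> N3 \<inter> (?S \<times> ?S)"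
      using q by auto
    show ?thesis
      using bspec[OF N1(3) q1] bspec[OF N2(3) q2] bspec[OF N3(3) q3]
      by (auto simp: stratum_index_def cell_type_def split: if_splits)
  qed
  then show ?thesis
    using N1(1,2) N2(1,2) N3(1,2) by (intro exI[of _ "N1 \<inter> N2 \<inter> N3"]) (auto intro: open_Int)
qed

lemma homotopic_scale:
  assumes cont: "continuous_on E c" "continuous_on E a" "continuous_on E b" "continuous_on E \<kappa>"
    and c: "\<And>p. p \<in> E \<Longrightarrow> c p \<noteq> 0"
    and inj: "\<And>p t. p \<in> E \<Longrightarrow> t \<in> {0..1} \<Longrightarrow>
      inj_on (\<lambda>i. (1 - parabola (\<kappa> p) t) * a p i + parabola (\<kappa> p) t * b p i) {1..n}"
  shows "homotopic_with_canon (\<lambda>_. True) E (Conf n) (\<lambda>p. scale n (c p) (a p)) (\<lambda>p. scale n (c p) (b p))"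
proof (rule homotopic_along_parabolas)
  show "continuous_on E (\<lambda>p. scale n (c p) (a p))" "continuous_on E (\<lambda>p. scale n (c p) (b p))"
    by (intro continuous_on_scale cont)+
  show "inj_on (\<lambda>i. (1 - parabola (\<kappa> p) t) * scale n (c p) (a p) i + parabola (\<kappa> p) t * scale n (c p) (b p) i) {1..n}"
    if "p \<in> E" "t \<in> {0..1}" for p t
  proof -
    have "inj_on (\<lambda>i. c p * ((1 - parabola (\<kappa> p) t) * a p i + parabola (\<kappa> p) t * b p i)) {1..n}"
      by (intro inj_on_mult_left c inj that)
    then show ?thesis
      by (rule inj_on_cong[THEN iffD1, rotated]) (simp add: scale_def algebra_simps)
  qed
qed (auto simp: scale_def cont)

text \<open>After division by \<open>u\<close> the path runs from 1 to \<open>r = v / u\<close>. The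
  segment meets 0 only if \<open>r\<close> is a negative real; in that case the parabola with
  \<open>\<kappa> = 1\<close> has nonzero imaginary part except at the ends.\<close>

lemma parabola_avoids_zero:
  assumes t: "t \<in> {0..1}" and u: "u \<noteq> 0" and v: "v \<noteq> 0"
    and \<kappa>: "\<kappa> = (if v / u \<in> \<real>\<^sub>\<le>\<^sub>0 then 1 else 0)"
  shows "(1 - parabola \<kappa> t) * u + parabola \<kappa> t * v \<noteq> 0"
proof
  assume eq0: "(1 - parabola \<kappa> t) * u + parabola \<kappa> t * v = 0"
  define r where "r = v / u"
  have v_eq: "v = r * u" using u by (simp add: r_def)
  have "((1 - parabola \<kappa> t) + parabola \<kappa> t * r) * u = 0"
    using eq0 by (simp add: v_eq algebra_simps)
  then have eq: "(1 - parabola \<kappa> t) + parabola \<kappa> t * r = 0" using u by simp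
  have r0: "r \<noteq> 0" using u v by (simp add: r_def)
  show False
  proof (cases "r \<in> \<real>\<^sub>\<le>\<^sub>0")
    case True
    then have \<kappa>1: "\<kappa> = 1" using \<kappa> by (simp add: r_def)
    have r: "Im r = 0" "Re r < 0"
      using True r0 by (auto simp: complex_nonpos_Reals_iff complex_eq_iff)
    have "t * (1 - t) * (Re r - 1) = 0"
      using arg_cong[OF eq, of Im] r by (simp add: parabola_def \<kappa>1 algebra_simps)
    then have "t = 0 \<or> t = 1" using r by simp
    then show False
      using arg_cong[OF eq, of Re] r by (auto simp: parabola_def \<kappa>1)
  next
    case False
    then have \<kappa>0: "\<kappa> = 0" using \<kappa> by (simp add: r_def)
    have re: "1 - t + t * Re r = 0" and im: "t * Im r = 0"
      using arg_cong[OF eq, of Re] arg_cong[OF eq, of Im] by (auto simp: parabola_def \<kappa>0)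
    have "t \<noteq> 0" using re by auto
    then have "t > 0" "Im r = 0" using t im by auto
    moreover have "t * Re r \<le> 0" using re t by auto
    ultimately have "r \<in> \<real>\<^sub>\<le>\<^sub>0"
      by (auto simp: complex_nonpos_Reals_iff mult_le_0_iff)
    then show False using False by blast
  qed
qed

text \<open>On a stratum the cell type is locally constant, so arbitrary choices that depend on it
  alone are continuous.\<close>

lemma continuous_on_cell_type:
  assumes n: "n \<ge> 2"
  shows "continuous_on {p \<in> Conf n \<times> Conf n. stratum_index n p = s} (\<lambda>p. G (cell_type n p))"
    (is "continuous_on ?E _")
proof (rule continuous_on_locally_constant)
  fix p assume p: "p \<in> ?E"
  then have "p \<in> Conf n \<times> Conf n" by simp
  from stratum_index_semicontinuous[OF n this] obtain N where N: "open N" "p \<in> N"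
    "\<forall>q\<in>N \<inter> (Conf n \<times> Conf n). stratum_index n p \<le> stratum_index n q \<and>
         (stratum_index n q = stratum_index n p \<longrightarrow> cell_type n q = cell_type n p)"
    by blast
  have "cell_type n q = cell_type n p" if "q \<in> N \<inter> ?E" for q
    using bspec[OF N(3), of q] that p by auto
  then show "\<exists>N. open N \<and> p \<in> N \<and> (\<forall>q\<in>N \<inter> ?E. G (cell_type n q) = G (cell_type n p))"
    using N(1,2) by (intro exI[of _ N]) auto
qed

text \<open>With the frame held fixed, the shape moves straight to the base point of its cell, then
  along a parabola to the base point of the target cell, then straight to the target shape. Finally
  the frame moves to the target frame with the shape held fixed.\<close>

lemma homotopic_on_stratum:
  fixes s :: nat
  assumes n: "n \<ge> 2"
  defines "S \<equiv> Conf n :: (nat \<Rightarrow> complex) set"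
  defines "E \<equiv> {p \<in> S \<times> S. stratum_index n p = s}"
  shows "homotopic_with_canon (\<lambda>_. True) E S fst snd"
proof -
  note locally_const = continuous_on_cell_type[OF n, of s, folded S_def, folded E_def]
  define base where "base d = (SOME z. z \<in> S \<and> lex_pattern n z = d)" for d
  have base: "base (lex_pattern n z) \<in> S" "lex_pattern n (base (lex_pattern n z)) = lex_pattern n z"
    if "z \<in> S" for z
    using someI[of "\<lambda>z'. z' \<in> S \<and> lex_pattern n z' = lex_pattern n z" z] that
    unfolding base_def by auto
  define K where "K z z' = (SOME \<kappa>. \<forall>t\<in>{0..1}.
      inj_on (\<lambda>i. (1 - parabola \<kappa> t) * z i + parabola \<kappa> t * z' i) {1..n})" for z z' :: "nat \<Rightarrow> complex"
  have K: "\<forall>t\<in>{0..1}. inj_on (\<lambda>i. (1 - parabola (K z z') t) * z i + parabola (K z z') t * z' i) {1..n}"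
    if "z \<in> S" "z' \<in> S" for z z'
    unfolding K_def by (rule someI_ex, rule ex_injective_parabola) (use that in \<open>auto simp: S_def Conf_def\<close>)
  let ?x = "\<lambda>p. shape n (fst p)" and ?y = "\<lambda>p. shape n (snd p)"
  let ?u = "\<lambda>p. frame (fst p)" and ?v = "\<lambda>p. frame (snd p)"
  let ?a = "\<lambda>p. base (lex_pattern n (?x p))" and ?b = "\<lambda>p. base (lex_pattern n (?y p))"
  have E: "fst p \<in> S" "snd p \<in> S" "?x p \<in> S" "?y p \<in> S" "?u p \<noteq> 0" "?v p \<noteq> 0" if "p \<in> E" for p
    using that shape_in_Conf[OF n] frame_nonzero[OF n] by (auto simp: E_def S_def)
  have cx: "continuous_on E ?x"
    by (rule continuous_on_compose2[OF continuous_on_shape[OF n] continuous_on_fst[OF continuous_on_id]])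
       (use E in \<open>auto simp: S_def\<close>)
  have cy: "continuous_on E ?y"
    by (rule continuous_on_compose2[OF continuous_on_shape[OF n] continuous_on_snd[OF continuous_on_id]])
       (use E in \<open>auto simp: S_def\<close>)
  have cu: "continuous_on E ?u"
    by (rule continuous_on_compose2[OF continuous_on_frame[of UNIV] continuous_on_fst[OF continuous_on_id]]) simp
  have cv: "continuous_on E ?v"
    by (rule continuous_on_compose2[OF continuous_on_frame[of UNIV] continuous_on_snd[OF continuous_on_id]]) simp
  \<comment> \<open>Base points and parabolas come from unrestricted choice, but they depend only on
    the cell type.\<close>
  have ca: "continuous_on E ?a" and cb: "continuous_on E ?b"
    and c\<kappa>: "continuous_on E (\<lambda>p. K (?a p) (?b p))"
    and c\<kappa>': "continuous_on E (\<lambda>p. if ?v p / ?u p \<in> \<real>\<^sub>\<le>\<^sub>0 then 1 else 0 :: real)"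
    using locally_const[where G = "\<lambda>(d, d', _). base d"] locally_const[where G = "\<lambda>(d, d', _). base d'"]
      locally_const[where G = "\<lambda>(d, d', _). K (base d) (base d')"]
      locally_const[where G = "\<lambda>(d, d', neg). if neg then 1 else 0 :: real"]
    by (simp_all add: cell_type_def)
  have seg: "inj_on (\<lambda>i. (1 - parabola 0 t) * z i + parabola 0 t * z' i) {1..n}"
    if "lex_pattern n z = lex_pattern n z'" "z \<in> S" "t \<in> {0..1}" for z z' t
    using inj_on_segment_of_lex_pattern_eq[OF that(1) _ that(3)] that(2)
    by (simp add: parabola_def S_def Conf_def complex_of_real_def)
  have 1: "homotopic_with_canon (\<lambda>_. True) E S (\<lambda>p. scale n (?u p) (?x p)) (\<lambda>p. scale n (?u p) (?a p))"
    unfolding S_def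
    by (rule homotopic_scale[OF cu cx ca continuous_on_const[of E 0]]) (use E base seg in auto)
  have 2: "homotopic_with_canon (\<lambda>_. True) E S (\<lambda>p. scale n (?u p) (?a p)) (\<lambda>p. scale n (?u p) (?b p))"
    unfolding S_def
    by (rule homotopic_scale[OF cu ca cb c\<kappa>]) (use E base K in auto)
  have 3: "homotopic_with_canon (\<lambda>_. True) E S (\<lambda>p. scale n (?u p) (?b p)) (\<lambda>p. scale n (?u p) (?y p))"
    unfolding S_def
    by (rule homotopic_scale[OF cu cb cy continuous_on_const[of E 0]]) (use E base seg in auto)
  have 4: "homotopic_with_canon (\<lambda>_. True) E S (\<lambda>p. scale n (?u p) (?y p)) (\<lambda>p. scale n (?v p) (?y p))"
    unfolding S_def
  proof (rule homotopic_along_parabolas[OF continuous_on_scale[OF cu cy] continuous_on_scale[OF cv cy] c\<kappa>'])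
    fix p and t :: real assume p: "p \<in> E" and t: "t \<in> {0..1}"
    let ?z = "parabola (if ?v p / ?u p \<in> \<real>\<^sub>\<le>\<^sub>0 then 1 else 0) t"
    have "(1 - ?z) * ?u p + ?z * ?v p \<noteq> 0"
      by (rule parabola_avoids_zero[OF t E(5,6)[OF p] refl])
    then have "inj_on (\<lambda>i. ((1 - ?z) * ?u p + ?z * ?v p) * ?y p i) {1..n}"
      using E(4)[OF p] by (intro inj_on_mult_left) (auto simp: S_def Conf_def)
    then show "inj_on (\<lambda>i. (1 - ?z) * scale n (?u p) (?y p) i + ?z * scale n (?v p) (?y p) i) {1..n}"
      by (rule inj_on_cong[THEN iffD1, rotated]) (simp add: scale_def algebra_simps)
  qed (auto simp: scale_def)
  have "homotopic_with_canon (\<lambda>_. True) E S (\<lambda>p. scale n (?u p) (?x p)) (\<lambda>p. scale n (?v p) (?y p))"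
    using 1 2 3 4 by (blast intro: homotopic_with_trans)
  then show ?thesis
    by (rule homotopic_with_eq) (auto simp: E_def S_def scale_frame_shape[OF n])
qed

text \<open>By semicontinuity the sets \<open>W s\<close> are open, so each stratum, being
  \<open>W s - W (Suc s)\<close>, is closed in the open set \<open>W s\<close> and its motion can be
  thickened.\<close>

lemma has_motion_planner_Conf:
  assumes n: "n \<ge> 2"
  shows "has_motion_planner (top_of_set (Conf n :: (nat \<Rightarrow> complex) set)) (2 * n - 2)"
proof -
  let ?S = "Conf n :: (nat \<Rightarrow> complex) set"
  define W where "W s = {p \<in> ?S \<times> ?S. s \<le> stratum_index n p}" for s
  have W: "openin (top_of_set (?S \<times> ?S)) (W s)" for s
  proof (subst openin_subopen, intro ballI)
    fix p assume p: "p \<in> W s"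
    then have pS: "p \<in> ?S \<times> ?S" by (simp add: W_def)
    from stratum_index_semicontinuous[OF n this] obtain N where N: "open N" "p \<in> N"
      "\<forall>q\<in>N \<inter> (?S \<times> ?S). stratum_index n p \<le> stratum_index n q"
      by blast
    have "(?S \<times> ?S) \<inter> N \<subseteq> W s"
    proof
      fix q assume q: "q \<in> (?S \<times> ?S) \<inter> N"
      then have "stratum_index n p \<le> stratum_index n q" using N(3) by blast
      then show "q \<in> W s" using p q by (simp add: W_def)
    qed
    then show "\<exists>T. openin (top_of_set (?S \<times> ?S)) T \<and> p \<in> T \<and> T \<subseteq> W s"
      using N(1,2) pS by (intro exI[of _ "(?S \<times> ?S) \<inter> N"]) (auto simp: openin_open_Int)
  qed
  define good where "good s U \<longleftrightarrow> openin (top_of_set (?S \<times> ?S)) U \<and>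
      {p \<in> ?S \<times> ?S. stratum_index n p = s} \<subseteq> U \<and> homotopic_with_canon (\<lambda>_. True) U ?S fst snd"
    for s U
  have "\<exists>U. good s U" for s
  proof -
    have "openin (top_of_set (W s)) (W (Suc s))"
      by (rule openin_subset_trans[OF W]) (auto simp: W_def)
    then have "closedin (top_of_set (W s)) (W s - W (Suc s))"
      by (simp add: closedin_diff)
    moreover have "W s - W (Suc s) = {p \<in> ?S \<times> ?S. stratum_index n p = s}"
      by (auto simp: W_def)
    ultimately have "closedin (top_of_set (W s)) {p \<in> ?S \<times> ?S. stratum_index n p = s}"
      by simp
    from thicken_motion_planner[OF W this homotopic_on_stratum[OF n]] show ?thesis
      unfolding good_def .
  qed
  then obtain U where "\<And>s. good s (U s)" by metis
  then have U: "\<And>s. openin (top_of_set (?S \<times> ?S)) (U s)"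
      "\<And>s. {p \<in> ?S \<times> ?S. stratum_index n p = s} \<subseteq> U s"
      "\<And>s. homotopic_with_canon (\<lambda>_. True) (U s) ?S fst snd"
    unfolding good_def by blast+
  \<comment> \<open>The least index is 2 + 2 + 0 and the greatest \<open>n + n + 1\<close>; the
    shift by 3 makes the numbering begin at 1.\<close>
  have "?S \<times> ?S = (\<Union>i\<in>{1..2 * n - 2}. U (i + 3))"
  proof
    show "(\<Union>i\<in>{1..2 * n - 2}. U (i + 3)) \<subseteq> ?S \<times> ?S"
      using openin_imp_subset[OF U(1)] by blast
    show "?S \<times> ?S \<subseteq> (\<Union>i\<in>{1..2 * n - 2}. U (i + 3))"
    proof
      fix p assume p: "p \<in> ?S \<times> ?S"
      have "fst p \<in> ?S" "snd p \<in> ?S" using p by auto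
      then have "4 \<le> stratum_index n p" "stratum_index n p \<le> 2 * n + 1"
        using re_rank_shape_bounds[OF n, of "fst p"] re_rank_shape_bounds[OF n, of "snd p"]
        by (auto simp: stratum_index_def)
      then have "stratum_index n p - 3 \<in> {1..2 * n - 2}" "stratum_index n p - 3 + 3 = stratum_index n p"
        by auto
      moreover have "p \<in> U (stratum_index n p)" using U(2) p by blast
      ultimately show "p \<in> (\<Union>i\<in>{1..2 * n - 2}. U (i + 3))" by (metis UN_I)
    qed
  qed
  then show ?thesis
    unfolding has_motion_planner_top_of_set using U(1,3) by (intro exI[of _ "\<lambda>i. U (i + 3)"]) simp
qed

theorem corollary1:
  fixes n :: nat
  assumes "n \<ge> 2"
  shows "TC (config_space n (euclidean :: (real ^ 2) topology)) = enat (2 * n - 2)"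
proof -
  have "TC (config_space n (euclidean :: (real ^ 2) topology)) = TC (top_of_set (Conf n :: (nat \<Rightarrow> complex) set))"
    unfolding config_space_euclidean[symmetric]
    by (intro TC_homeomorphic config_space_homeomorphic real2_homeomorphic_complex)
  also have "\<dots> = enat (2 * n - 2)"
    unfolding TC_def
  proof (rule antisym)
    show "Inf {enat k |k. has_motion_planner (top_of_set (Conf n :: (nat \<Rightarrow> complex) set)) k} \<le> enat (2 * n - 2)"
      using has_motion_planner_Conf[OF assms] by (intro Inf_lower) blast
    show "enat (2 * n - 2) \<le> Inf {enat k |k. has_motion_planner (top_of_set (Conf n :: (nat \<Rightarrow> complex) set)) k}"
    proof (rule Inf_greatest, clarify)
      fix k assume planner: "has_motion_planner (top_of_set (Conf n :: (nat \<Rightarrow> complex) set)) k"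
      have "\<not> k \<le> 2 * n - 3"
        by (rule notI, rule notE[OF no_small_motion_planner planner])
      then show "enat (2 * n - 2) \<le> enat k" by simp
    qed
  qed
  finally show ?thesis .
qed

end
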